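(* Let $n=n_Q+\sum_{i=1}^m n_{P_i}$ and let $\hat f_a$ be the multi-source data-driven classifier defined in the context. There exists a constant $C>0$ (not depending on the sample sizes) such that $$\sup_{(P_1,\dots,P_m,Q)\in\Pi}\mathbb{E}\,\mathcal{E}_Q(\hat f_a)\le C\left(\frac{n_Q}{\log n}+\sum_{i=1}^m\left(\frac{n_{P_i}}{\log n}\right)^{\frac{2\beta+d}{2\gamma_i\beta+d}}\right)^{-\frac{\beta(1+\alpha)}{2\beta+d}} .$$
   Context: **Data.** $d,m\ge1$; $P_1,\dots,P_m,Q$ are probability distributions of a pair $(X,Y)$ on $[0,1]^d\times\{0,1\}$, with $X$-marginals $P_{i,X},Q_X$. One observes $n_{P_i}$ i.i.d. pairs $(X_j^{P_i},Y_j^{P_i})\sim P_i$ for each $i\in[m]=\{1,\dots,m\}$ and $n_Q$ i.i.d. pairs $(X_j^Q,Y_j^Q)\sim Q$, all independent (sample sizes are nonnegative integers with $n\ge2$). $\mathbb{E}$ is expectation over all observed data. **Regression functions and risk.** For $G\in\{P_1,\dots,P_m,Q\}$, $\eta_G(x)=G(Y=1|X=x)$ for $x\in\mathrm{supp}(G_X)$ and $\frac12$ otherwise. The Bayes classifier is $f_Q^*(x)=0$ if $\eta_Q(x)\le\frac12$ and $1$ otherwise. For a classifier $\hat f$ (with values in $\{0,1\}$), $R_Q(\hat f)=\mathbb{P}_{(X,Y)\sim Q}(Y\ne\hat f(X))$ and $\mathcal{E}_Q(\hat f)=R_Q(\hat f)-R_Q(f_Q^* )$. **Parameter space.** Fix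 $\alpha\ge0$, $C_\alpha>0$, $0<\beta\le1$, $C_\beta>0$, $\boldsymbol\gamma=(\gamma_1,\dots,\gamma_m)$ with $\gamma_i>0$, constants $C_1,\dots,C_m>0$, $\mu=(\mu_-,\mu_+)$ with $0<\mu_-<\mu_+$, $c_\mu>0$, $r_\mu>0$, with $\alpha\beta\le d$. $\Pi=\Pi(\alpha,\beta,\boldsymbol\gamma,\mu)$ is the set of tuples $(P_1,\dots,P_m,Q)$ such that: (i) for each $i\in[m]$ and all $x\in\mathrm{supp}(P_{i,X})\cup\mathrm{supp}(Q_X)$: $(\eta_{P_i}(x)-\frac12)(\eta_Q(x)-\frac12)\ge0$ and $|\eta_{P_i}(x)-\frac12|\ge C_i|\eta_Q(x)-\frac12|^{\gamma_i}$; (ii) $Q_X(0<|\eta_Q(X)-\frac12|<t)\le C_\alpha t^\alpha$ for all $t>0$; (iii) $|\eta_Q(x_1)-\eta_Q(x_2)|\le C_\beta\|x_1-x_2\|^\beta$ for all $x_1,x_2\in\mathrm{supp}(Q_X)$ (Euclidean norm); (iv) for each $i\in[m]$: $P_{i,X},Q_X$ are absolutely continuous with respect to Lebesgue measure $\lambda$ on $\mathbb{R}^d$, $\Omega:=\mathrm{supp}(P_{i,X})=\mathrm{supp}(Q_X)$, $\lambda[\Omega\cap B(x,r)]\ge c_\mu\lambda[B(x,r)]$ for all $0<r\le r_\mu$, $x\in\Omega$, and both densities lie strictly between $\mu_-$ and $\mu_+$ at every $x\in\Omega$. **Classifier $\hat f_a$.** Let $Y^{P_i}_{(j)}(x)$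 (resp. $Y^Q_{(j)}(x)$) be the label of the $j$-th nearest covariate to $x$ among the $P_i$-data (resp. $Q$-data). For a point $x$ and $k=1,\dots,n$, consider the $k$ nearest covariates to $x$ among all covariates of all samples; let $k_{P_i}^{(k)}$ and $k_Q^{(k)}$ be the numbers of them coming from the $P_i$-data and the $Q$-data. Put $\hat\eta_{P_i}^{(k)}=\frac1{k_{P_i}^{(k)}}\sum_{j=1}^{k_{P_i}^{(k)}}Y^{P_i}_{(j)}(x)$ and $\hat\eta_Q^{(k)}=\frac1{k_Q^{(k)}}\sum_{j=1}^{k_Q^{(k)}}Y^Q_{(j)}(x)$ (each set to $\frac12$ when the corresponding count is $0$). Define $$\hat r_+^{(k)}=\mathbb{I}\{\hat\eta_Q^{(k)}\ge\tfrac12\}k_Q^{(k)}(\hat\eta_Q^{(k)}-\tfrac12)^2+\sum_{i=1}^m\mathbb{I}\{\hat\eta_{P_i}^{(k)}\ge\tfrac12\}k_{P_i}^{(k)}(\hat\eta_{P_i}^{(k)}-\tfrac12)^2,$$ $$\hat r_-^{(k)}=\mathbb{I}\{\hat\eta_Q^{(k)}<\tfrac12\}k_Q^{(k)}(\hat\eta_Q^{(k)}-\tfrac12)^2+\sum_{i=1}^m\mathbb{I}\{\hat\eta_{P_i}^{(k)}<\tfrac12\}k_{P_i}^{(k)}(\hat\eta_{P_i}^{(k)}-\tfrac12)^2,$$ $\hat r^{(k)}=\max\{\hat r_+^{(k)},\hat r_-^{(k)}\}$ and $\hat f^{(k)}(x)=\mathbb{I}\{\hat r_+^{(k)}\ge\hat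 r_-^{(k)}\}$. Let $k^*$ be the smallest $k$ with $\hat r^{(k)}>(d+3)\log n$ if such $k$ exists, and otherwise $k^*\in\arg\max_k\hat r^{(k)}$. Then $\hat f_a(x)=\hat f^{(k^* )}(x)$. *)

theory Defs
  imports "HOL-Probability.Probability"
begin

section \<open>Populations, regression functions and risk\<close>

text \<open>
  The dimension \<open>d\<close> is \<open>CARD('d)\<close>, the number of source populations \<open>m\<close> is \<open>CARD('m)\<close>.
  Labels in \<open>{0,1}\<close> are Booleans (\<open>True\<close> is 1).
\<close>

definition obs_space :: "((real^'d) \<times> bool) measure" where
  "obs_space = borel \<Otimes>\<^sub>M count_space UNIV"

definition population :: "((real^'d) \<times> bool) measure \<Rightarrow> bool" where
  "population G \<longleftrightarrow> prob_space G \<and> sets G = sets obs_space \<and> (AE z in G. fst z \<in> cbox 0 1)"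

definition covariate_law :: "((real^'d) \<times> bool) measure \<Rightarrow> (real^'d) measure" where
  "covariate_law G = distr G borel fst"

definition msupport :: "'a::topological_space measure \<Rightarrow> 'a set" where
  "msupport M = {x. \<forall>U. open U \<longrightarrow> x \<in> U \<longrightarrow> emeasure M U > 0}"

text \<open>
  The conditional probability \<open>G(Y = 1 | X = x)\<close> is determined by \<open>G\<close> only up to a null set of
  the covariate law, whereas the conditions on the parameter space are imposed at every point of
  the support. A regression function is therefore any version of this conditional probability,
  set to \<open>1/2\<close> off the support.
\<close>

definition regression_function :: "((real^'d) \<times> bool) measure \<Rightarrow> (real^'d \<Rightarrow> real) \<Rightarrow> bool" where
  "regression_function G \<eta> \<longleftrightarrow>
     \<eta> \<in> borel_measurable borel \<and>
     (\<forall>x. 0 \<le> \<eta> x \<and> \<eta> x \<le> 1) \<and>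
     (\<forall>A\<in>sets borel. measure G (A \<times> {True}) = (LINT x:A|covariate_law G. \<eta> x)) \<and>
     (\<forall>x. x \<notin> msupport (covariate_law G) \<longrightarrow> \<eta> x = 1/2)"

definition bayes_classifier :: "(real^'d \<Rightarrow> real) \<Rightarrow> real^'d \<Rightarrow> bool" where
  "bayes_classifier \<eta> x \<longleftrightarrow> \<not> \<eta> x \<le> 1/2"

definition risk :: "((real^'d) \<times> bool) measure \<Rightarrow> (real^'d \<Rightarrow> bool) \<Rightarrow> real" where
  "risk Q f = measure Q {z \<in> space Q. snd z \<noteq> f (fst z)}"

definition excess_risk ::
  "((real^'d) \<times> bool) measure \<Rightarrow> (real^'d \<Rightarrow> real) \<Rightarrow> (real^'d \<Rightarrow> bool) \<Rightarrow> real" where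
  "excess_risk Q \<eta>Q f = risk Q f - risk Q (bayes_classifier \<eta>Q)"


section \<open>Parameter space\<close>

definition density_between :: "real \<Rightarrow> real \<Rightarrow> (real^'d) measure \<Rightarrow> bool" where
  "density_between \<mu>lo \<mu>hi M \<longleftrightarrow>
     (\<exists>p. p \<in> borel_measurable borel \<and> (\<forall>x. 0 \<le> p x) \<and>
          M = density lborel (\<lambda>x. ennreal (p x)) \<and>
          (\<forall>x\<in>msupport M. \<mu>lo < p x \<and> p x < \<mu>hi))"

text \<open>
  An element \<open>(P, \<eta>P, Q, \<eta>Q)\<close> of the parameter space is a tuple of populations together with the
  versions of their regression functions for which the conditions hold.
\<close>

definition parameter_space ::
  "real \<Rightarrow> real \<Rightarrow> real \<Rightarrow> real \<Rightarrow> ('m \<Rightarrow> real) \<Rightarrow> ('m \<Rightarrow> real) \<Rightarrow> real \<Rightarrow> real \<Rightarrow> real \<Rightarrow> real \<Rightarrow>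
   (('m \<Rightarrow> ((real^'d) \<times> bool) measure) \<times> ('m \<Rightarrow> real^'d \<Rightarrow> real) \<times>
    ((real^'d) \<times> bool) measure \<times> (real^'d \<Rightarrow> real)) set" where
  "parameter_space \<alpha> C\<alpha> \<beta> C\<beta> \<gamma> Cs \<mu>lo \<mu>hi c\<mu> r\<mu> =
     {(P, \<eta>P, Q, \<eta>Q).
        (\<forall>i. population (P i) \<and> regression_function (P i) (\<eta>P i)) \<and>
        population Q \<and> regression_function Q \<eta>Q \<and>
        (\<forall>i. \<forall>x \<in> msupport (covariate_law (P i)) \<union> msupport (covariate_law Q).
           (\<eta>P i x - 1/2) * (\<eta>Q x - 1/2) \<ge> 0 \<and>
           \<bar>\<eta>P i x - 1/2\<bar> \<ge> Cs i * \<bar>\<eta>Q x - 1/2\<bar> powr \<gamma> i) \<and>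
        (\<forall>t>0. measure (covariate_law Q) {x. 0 < \<bar>\<eta>Q x - 1/2\<bar> \<and> \<bar>\<eta>Q x - 1/2\<bar> < t}
                 \<le> C\<alpha> * t powr \<alpha>) \<and>
        (\<forall>x1 \<in> msupport (covariate_law Q). \<forall>x2 \<in> msupport (covariate_law Q).
           \<bar>\<eta>Q x1 - \<eta>Q x2\<bar> \<le> C\<beta> * norm (x1 - x2) powr \<beta>) \<and>
        (\<forall>i. msupport (covariate_law (P i)) = msupport (covariate_law Q) \<and>
             density_between \<mu>lo \<mu>hi (covariate_law (P i))) \<and>
        density_between \<mu>lo \<mu>hi (covariate_law Q) \<and>
        (\<forall>x \<in> msupport (covariate_law Q). \<forall>r. 0 < r \<longrightarrow> r \<le> r\<mu> \<longrightarrow>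
           measure lborel (msupport (covariate_law Q) \<inter> ball x r)
             \<ge> c\<mu> * measure lborel (ball x r))}"


section \<open>Observed data\<close>

text \<open>
  Populations are labelled by \<open>'m option\<close>: \<open>Some i\<close> is the source \<open>P i\<close> and \<open>None\<close> is the
  target \<open>Q\<close>. A data set maps the index \<open>(g, j)\<close> to the \<open>j\<close>-th observation from population \<open>g\<close>,
  counting from \<open>0\<close>.
\<close>

definition sample_indices :: "('m \<Rightarrow> nat) \<Rightarrow> nat \<Rightarrow> ('m option \<times> nat) set" where
  "sample_indices nP nQ = (SIGMA g:UNIV. {..<case_option nQ nP g})"

definition total_size :: "('m::finite \<Rightarrow> nat) \<Rightarrow> nat \<Rightarrow> nat" where
  "total_size nP nQ = nQ + (\<Sum>i\<in>UNIV. nP i)"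

definition data_law ::
  "('m \<Rightarrow> ((real^'d) \<times> bool) measure) \<Rightarrow> ((real^'d) \<times> bool) measure \<Rightarrow> ('m \<Rightarrow> nat) \<Rightarrow> nat \<Rightarrow>
   ('m option \<times> nat \<Rightarrow> (real^'d) \<times> bool) measure" where
  "data_law P Q nP nQ = PiM (sample_indices nP nQ) (\<lambda>(g, j). case_option Q P g)"

definition data_space ::
  "('m \<Rightarrow> nat) \<Rightarrow> nat \<Rightarrow> ('m option \<times> nat \<Rightarrow> (real^'d) \<times> bool) measure" where
  "data_space nP nQ = PiM (sample_indices nP nQ) (\<lambda>_. obs_space)"

definition expected_excess_risk ::
  "('m \<Rightarrow> ((real^'d) \<times> bool) measure) \<Rightarrow> ((real^'d) \<times> bool) measure \<Rightarrow> (real^'d \<Rightarrow> real) \<Rightarrow>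
   ('m \<Rightarrow> nat) \<Rightarrow> nat \<Rightarrow> (('m option \<times> nat \<Rightarrow> (real^'d) \<times> bool) \<Rightarrow> real^'d \<Rightarrow> bool) \<Rightarrow> real" where
  "expected_excess_risk P Q \<eta>Q nP nQ f =
     (\<integral>\<omega>. excess_risk Q \<eta>Q (f \<omega>) \<partial>data_law P Q nP nQ)"


section \<open>The data-driven classifier\<close>

text \<open>
  A ranking lists all sample indices by nondecreasing distance of the covariates to \<open>x\<close>; ties may
  be broken in any way. The nearest neighbours within one population are read off the same list.
\<close>

definition nn_ranking ::
  "('m \<Rightarrow> nat) \<Rightarrow> nat \<Rightarrow> ('m option \<times> nat \<Rightarrow> (real^'d) \<times> bool) \<Rightarrow> real^'d \<Rightarrow>
   ('m option \<times> nat) list \<Rightarrow> bool" where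
  "nn_ranking nP nQ \<omega> x xs \<longleftrightarrow>
     distinct xs \<and> set xs = sample_indices nP nQ \<and> sorted (map (\<lambda>a. dist x (fst (\<omega> a))) xs)"

definition nn_count :: "('m option \<times> nat) list \<Rightarrow> 'm option \<Rightarrow> nat \<Rightarrow> nat" where
  "nn_count xs g k = length (filter (\<lambda>a. fst a = g) (take k xs))"

text \<open>The label of the \<open>j\<close>-th nearest covariate from population \<open>g\<close>, for \<open>j \<ge> 1\<close>.\<close>

definition nn_label ::
  "('m option \<times> nat \<Rightarrow> (real^'d) \<times> bool) \<Rightarrow> ('m option \<times> nat) list \<Rightarrow> 'm option \<Rightarrow> nat \<Rightarrow> real" where
  "nn_label \<omega> xs g j = of_bool (snd (\<omega> (filter (\<lambda>a. fst a = g) xs ! (j - 1))))"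

definition eta_hat ::
  "('m option \<times> nat \<Rightarrow> (real^'d) \<times> bool) \<Rightarrow> ('m option \<times> nat) list \<Rightarrow> 'm option \<Rightarrow> nat \<Rightarrow> real" where
  "eta_hat \<omega> xs g k =
     (if nn_count xs g k = 0 then 1/2
      else 1 / real (nn_count xs g k) * (\<Sum>j = 1..nn_count xs g k. nn_label \<omega> xs g j))"

definition r_plus ::
  "('m::finite option \<times> nat \<Rightarrow> (real^'d) \<times> bool) \<Rightarrow> ('m option \<times> nat) list \<Rightarrow> nat \<Rightarrow> real" where
  "r_plus \<omega> xs k =
     of_bool (eta_hat \<omega> xs None k \<ge> 1/2)
       * real (nn_count xs None k) * (eta_hat \<omega> xs None k - 1/2)^2
     + (\<Sum>i\<in>UNIV. of_bool (eta_hat \<omega> xs (Some i) k \<ge> 1/2)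
          * real (nn_count xs (Some i) k) * (eta_hat \<omega> xs (Some i) k - 1/2)^2)"

definition r_minus ::
  "('m::finite option \<times> nat \<Rightarrow> (real^'d) \<times> bool) \<Rightarrow> ('m option \<times> nat) list \<Rightarrow> nat \<Rightarrow> real" where
  "r_minus \<omega> xs k =
     of_bool (eta_hat \<omega> xs None k < 1/2)
       * real (nn_count xs None k) * (eta_hat \<omega> xs None k - 1/2)^2
     + (\<Sum>i\<in>UNIV. of_bool (eta_hat \<omega> xs (Some i) k < 1/2)
          * real (nn_count xs (Some i) k) * (eta_hat \<omega> xs (Some i) k - 1/2)^2)"

definition r_hat ::
  "('m::finite option \<times> nat \<Rightarrow> (real^'d) \<times> bool) \<Rightarrow> ('m option \<times> nat) list \<Rightarrow> nat \<Rightarrow> real" where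
  "r_hat \<omega> xs k = max (r_plus \<omega> xs k) (r_minus \<omega> xs k)"

definition f_hat ::
  "('m::finite option \<times> nat \<Rightarrow> (real^'d) \<times> bool) \<Rightarrow> ('m option \<times> nat) list \<Rightarrow> nat \<Rightarrow> bool" where
  "f_hat \<omega> xs k \<longleftrightarrow> r_plus \<omega> xs k \<ge> r_minus \<omega> xs k"

definition k_star ::
  "('m::finite \<Rightarrow> nat) \<Rightarrow> nat \<Rightarrow> ('m option \<times> nat \<Rightarrow> (real^'d) \<times> bool) \<Rightarrow>
   ('m option \<times> nat) list \<Rightarrow> nat \<Rightarrow> bool" where
  "k_star nP nQ \<omega> xs k \<longleftrightarrow>
     (let n = total_size nP nQ;
          exceeds = (\<lambda>k. r_hat \<omega> xs k > (real CARD('d) + 3) * ln (real n))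
      in k \<in> {1..n} \<and>
         (if \<exists>k'\<in>{1..n}. exceeds k'
          then exceeds k \<and> (\<forall>k'\<in>{1..n}. exceeds k' \<longrightarrow> k \<le> k')
          else (\<forall>k'\<in>{1..n}. r_hat \<omega> xs k' \<le> r_hat \<omega> xs k)))"

text \<open>
  The construction leaves open how distance ties are broken and which maximiser is taken when the
  threshold is never exceeded. The predicate holds for the result of every choice that makes the
  classifier a measurable function of the data and the query point, so that its expected risk is
  defined.
\<close>

definition data_driven_classifier ::
  "('m::finite \<Rightarrow> nat) \<Rightarrow> nat \<Rightarrow>
   (('m option \<times> nat \<Rightarrow> (real^'d) \<times> bool) \<Rightarrow> real^'d \<Rightarrow> bool) \<Rightarrow> bool" where
  "data_driven_classifier nP nQ f \<longleftrightarrow>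
     (\<lambda>(\<omega>, x). f \<omega> x) \<in> measurable (data_space nP nQ \<Otimes>\<^sub>M borel) (count_space UNIV) \<and>
     (\<forall>\<omega>\<in>space (data_space nP nQ). \<forall>x.
        \<exists>xs k. nn_ranking nP nQ \<omega> x xs \<and> k_star nP nQ \<omega> xs k \<and> f \<omega> x = f_hat \<omega> xs k)"

text \<open>The predicate is not vacuous: some choice is measurable.\<close>

lemma finite_sample_indices: "finite (sample_indices (nP :: 'm::finite \<Rightarrow> nat) nQ)"
  unfolding sample_indices_def by (intro finite_SigmaI) auto

lemma data_driven_classifier_exists:
  assumes "total_size (nP :: 'm::finite \<Rightarrow> nat) nQ \<ge> 1"
  shows "\<exists>f :: ('m option \<times> nat \<Rightarrow> (real^'d::finite) \<times> bool) \<Rightarrow> real^'d \<Rightarrow> bool. data_driven_classifier nP nQ f"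
proof -
  let ?I = "sample_indices nP nQ"
  let ?n = "total_size nP nQ"
  let ?M = "data_space nP nQ \<Otimes>\<^sub>M (borel :: (real^'d) measure)"
  define X where "X = {xs. distinct xs \<and> set xs = ?I}"
  have finX: "finite X"
  proof (rule finite_subset)
    show "X \<subseteq> {xs. set xs \<subseteq> ?I \<and> length xs = card ?I}"
      by (auto simp: X_def simp flip: distinct_card)
    show "finite {xs. set xs \<subseteq> ?I \<and> length xs = card ?I}"
      by (rule finite_lists_length_eq[OF finite_sample_indices])
  qed
  obtain ps where ps: "set ps = X" using finX finite_list by blast
  define rk where "rk = (\<lambda>\<omega> x. ps ! (LEAST i. i < length ps \<and> sorted (map (\<lambda>a. dist x (fst ((\<omega> :: 'm option \<times> nat \<Rightarrow> (real^'d) \<times> bool) a))) (ps ! i))))"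
  define ks where "ks = (\<lambda>\<omega> xs. LEAST k. k_star nP nQ (\<omega> :: 'm option \<times> nat \<Rightarrow> (real^'d) \<times> bool) xs k)"
  define f where "f = (\<lambda>\<omega> x. f_hat \<omega> (rk \<omega> x) (ks \<omega> (rk \<omega> x)))"
  have ex_rank: "\<exists>xs. nn_ranking nP nQ \<omega> x xs" for \<omega> :: "'m option \<times> nat \<Rightarrow> (real^'d) \<times> bool" and x
  proof -
    obtain l where l: "set l = ?I" "distinct l" using finite_distinct_list[OF finite_sample_indices] by blast
    show ?thesis unfolding nn_ranking_def
      by (rule exI[of _ "sort_key (\<lambda>a. dist x (fst (\<omega> a))) l"]) (use l in simp)
  qed
  have rk: "nn_ranking nP nQ \<omega> x (rk \<omega> x)" for \<omega> x
  proof -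
    obtain xs where xs: "nn_ranking nP nQ \<omega> x xs" using ex_rank by blast
    then have "xs \<in> set ps" by (auto simp: ps X_def nn_ranking_def)
    then obtain i where "i < length ps" "ps ! i = xs" by (auto simp: in_set_conv_nth)
    with xs have ex: "\<exists>i. i < length ps \<and> sorted (map (\<lambda>a. dist x (fst (\<omega> a))) (ps ! i))"
      by (auto simp: nn_ranking_def)
    from LeastI_ex[OF ex] have 1: "(LEAST i. i < length ps \<and> sorted (map (\<lambda>a. dist x (fst (\<omega> a))) (ps ! i))) < length ps"
      and 2: "sorted (map (\<lambda>a. dist x (fst (\<omega> a))) (rk \<omega> x))" by (auto simp: rk_def)
    from 1 have "rk \<omega> x \<in> X" by (simp flip: ps add: rk_def)
    with 2 show ?thesis by (auto simp: nn_ranking_def X_def)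
  qed
  have ks: "k_star nP nQ \<omega> xs (ks \<omega> xs)" for \<omega> :: "'m option \<times> nat \<Rightarrow> (real^'d) \<times> bool" and xs
  proof -
    have "\<exists>k. k_star nP nQ \<omega> xs k"
    proof (cases "\<exists>k'\<in>{1..?n}. r_hat \<omega> xs k' > (real CARD('d) + 3) * ln (real ?n)")
      case True
      let ?P = "\<lambda>k'. k' \<in> {1..?n} \<and> r_hat \<omega> xs k' > (real CARD('d) + 3) * ln (real ?n)"
      from True have "\<exists>k. ?P k" by blast
      from LeastI_ex[OF this] Least_le[of ?P] True show ?thesis unfolding k_star_def Let_def
        by (intro exI[of _ "LEAST k. ?P k"]) auto
    next
      case False
      have "finite (r_hat \<omega> xs ` {1..?n})" "r_hat \<omega> xs ` {1..?n} \<noteq> {}" using assms by auto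
      from Max_in[OF this] obtain k where "k \<in> {1..?n}" "r_hat \<omega> xs k = Max (r_hat \<omega> xs ` {1..?n})" by auto
      with False show ?thesis unfolding k_star_def Let_def
        by (intro exI[of _ k]) auto
    qed
    then show ?thesis unfolding ks_def by (rule LeastI_ex)
  qed
  have comp: "(\<lambda>z. fst z a) \<in> ?M \<rightarrow>\<^sub>M obs_space" if "a \<in> ?I" for a
    using that unfolding data_space_def by (intro measurable_compose[OF measurable_fst measurable_component_singleton])
  have cx: "(\<lambda>z. fst (fst z a)) \<in> ?M \<rightarrow>\<^sub>M borel" and cy: "(\<lambda>z. snd (fst z a)) \<in> ?M \<rightarrow>\<^sub>M count_space UNIV"
    if "a \<in> ?I" for a
    using measurable_compose[OF comp[OF that, unfolded obs_space_def] measurable_fst]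
      measurable_compose[OF comp[OF that, unfolded obs_space_def] measurable_snd] .
  have srt: "Measurable.pred ?M (\<lambda>z. sorted (map (\<lambda>a. dist (snd z) (fst (fst z a))) xs))" if "xs \<in> X" for xs
  proof -
    have I: "xs ! i \<in> ?I" if "i < length xs" for i using nth_mem[OF that] \<open>xs \<in> X\<close> unfolding X_def by simp
    have "Measurable.pred ?M (\<lambda>z. \<forall>j\<in>{..<length xs}. \<forall>i\<in>{..<j}. dist (snd z) (fst (fst z (xs!i))) \<le> dist (snd z) (fst (fst z (xs!j))))"
    proof (intro pred_intros_finite)
      fix i j assume "j \<in> {..<length xs}" "i \<in> {..<j}"
      then have "xs ! i \<in> ?I" "xs ! j \<in> ?I" using I by auto
      note [measurable] = cx[OF this(1)] cx[OF this(2)]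
      show "Measurable.pred ?M (\<lambda>z. dist (snd z) (fst (fst z (xs!i))) \<le> dist (snd z) (fst (fst z (xs!j))))"
        by measurable
    qed auto
    also have "(\<lambda>z. \<forall>j\<in>{..<length xs}. \<forall>i\<in>{..<j}. dist (snd z) (fst (fst z (xs!i))) \<le> dist (snd z) (fst (fst z (xs!j))))
       = (\<lambda>z. sorted (map (\<lambda>a. dist (snd z) (fst (fst z a))) xs))"
      by (auto simp: sorted_wrt_iff_nth_less fun_eq_iff)
    finally show ?thesis .
  qed
  have lab: "(\<lambda>z. nn_label (fst z) xs g j) \<in> borel_measurable ?M" if "xs \<in> X" "j \<in> {1..nn_count xs g k}" for xs g j k
  proof -
    let ?l = "filter (\<lambda>a. fst a = g) xs"
    have "length (filter (\<lambda>a. fst a = g) (take k xs)) \<le> length ?l"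
      by (metis append_take_drop_id filter_append le_add1 length_append)
    then have "?l ! (j - 1) \<in> set ?l" using that(2) by (intro nth_mem) (auto simp: nn_count_def)
    then have "?l ! (j - 1) \<in> ?I" using that(1) by (auto simp: X_def)
    note [measurable] = cy[OF this]
    show ?thesis unfolding nn_label_def by measurable
  qed
  have eta: "(\<lambda>z. eta_hat (fst z) xs g k) \<in> borel_measurable ?M" if "xs \<in> X" for xs g k
  proof (cases "nn_count xs g k = 0")
    case False
    have "(\<lambda>z. \<Sum>j = 1..nn_count xs g k. nn_label (fst z) xs g j) \<in> borel_measurable ?M"
      by (rule borel_measurable_sum) (rule lab[OF that])
    from borel_measurable_divide[OF this borel_measurable_const[of "real (nn_count xs g k)"]] False
    show ?thesis unfolding eta_hat_def by simp
  qed (simp add: eta_hat_def)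
  have rp: "(\<lambda>z. r_plus (fst z) xs k) \<in> borel_measurable ?M" and rm: "(\<lambda>z. r_minus (fst z) xs k) \<in> borel_measurable ?M"
    if "xs \<in> X" for xs k
  proof -
    note [measurable] = eta[OF that]
    show "(\<lambda>z. r_plus (fst z) xs k) \<in> borel_measurable ?M" unfolding r_plus_def by measurable
    show "(\<lambda>z. r_minus (fst z) xs k) \<in> borel_measurable ?M" unfolding r_minus_def by measurable
  qed
  have kst: "(\<lambda>z. ks (fst z) xs) \<in> ?M \<rightarrow>\<^sub>M count_space UNIV" and fh: "\<And>k. Measurable.pred ?M (\<lambda>z. f_hat (fst z) xs k)" if "xs \<in> X" for xs
  proof -
    note [measurable] = rp[OF that] rm[OF that]
    show "(\<lambda>z. ks (fst z) xs) \<in> ?M \<rightarrow>\<^sub>M count_space UNIV"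
      unfolding ks_def k_star_def r_hat_def Let_def by measurable
    show "Measurable.pred ?M (\<lambda>z. f_hat (fst z) xs k)" for k
      unfolding f_hat_def by measurable
  qed
  have fx: "Measurable.pred ?M (\<lambda>z. f_hat (fst z) xs (ks (fst z) xs))" if "xs \<in> X" for xs
    by (rule measurable_compose_countable[OF fh[OF that] kst[OF that]])
  define ix where "ix = (\<lambda>z :: ('m option \<times> nat \<Rightarrow> (real^'d) \<times> bool) \<times> (real^'d). LEAST i. i < length ps \<and> sorted (map (\<lambda>a. dist (snd z) (fst (fst z a))) (ps ! i)))"
  have ix1: "Measurable.pred ?M (\<lambda>z. i < length ps \<and> sorted (map (\<lambda>a. dist (snd z) (fst (fst z a))) (ps ! i)))" for i
    by (cases "i < length ps") (use srt[of "ps ! i"] ps in auto)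
  have ixm: "ix \<in> ?M \<rightarrow>\<^sub>M count_space UNIV"
    unfolding ix_def by (rule measurable_Least[OF ix1])
  have ixl: "ix z < length ps" for z
  proof -
    obtain xs where xs: "nn_ranking nP nQ (fst z) (snd z) xs" using ex_rank by blast
    then have "xs \<in> set ps" by (auto simp: ps X_def nn_ranking_def)
    then obtain i where "i < length ps" "ps ! i = xs" by (auto simp: in_set_conv_nth)
    with xs have "\<exists>i. i < length ps \<and> sorted (map (\<lambda>a. dist (snd z) (fst (fst z a))) (ps ! i))"
      by (auto simp: nn_ranking_def)
    from LeastI_ex[OF this] show ?thesis by (simp add: ix_def)
  qed
  have ixm': "ix \<in> ?M \<rightarrow>\<^sub>M count_space {..<length ps}"
    by (rule measurable_count_space_extend[OF _ _ ixm]) (auto simp: ixl)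
  have "Measurable.pred ?M (\<lambda>z. f_hat (fst z) (ps ! ix z) (ks (fst z) (ps ! ix z)))"
  proof (rule measurable_compose_countable'[OF _ ixm'])
    fix i assume "i \<in> {..<length ps}"
    then show "Measurable.pred ?M (\<lambda>z. f_hat (fst z) (ps ! i) (ks (fst z) (ps ! i)))"
      using ps by (intro fx) auto
  qed auto
  then have "(\<lambda>(\<omega>, x). f \<omega> x) \<in> ?M \<rightarrow>\<^sub>M count_space UNIV"
    by (simp add: f_def rk_def ix_def case_prod_beta')
  then have "data_driven_classifier nP nQ f"
    unfolding data_driven_classifier_def f_def using rk ks by blast
  then show ?thesis by blast
qed

end

theory Submission
  imports Defs
begin

text \<open>
  Fix a query point \<open>x\<close> and put \<open>\<zeta> = \<bar>\<eta>\<^sub>Q x - 1/2\<bar>\<close>. Holder continuity keeps \<open>\<eta>\<^sub>Q\<close> on the same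
  side of \<open>1/2\<close> as at \<open>x\<close>, at distance at least \<open>\<zeta>/2\<close>, on a ball of radius \<open>\<rho>\<close> proportional to
  \<open>\<zeta> powr (1/\<beta>)\<close>; the transfer condition carries this over to every source, with distance at least of order
  \<open>\<zeta> powr \<gamma> i\<close>. Inside this ball a neighbourhood can therefore vote for the wrong label only through
  noise, and two events suffice for a correct decision.

  \<^item> No neighbourhood inside the ball has a wrong signal above the threshold
  (\<open>prob_misleading\<close>). Every label in the ball favours the right side, so replacing all labels by
  fair coins independent of the covariates can only make the wrong signal larger
  (\<open>nn_integral_PiM_le_fair_labels\<close>). With the covariates fixed, a signal is then a sum over the
  populations of squared coin sums normalised by their lengths. Its exponential moment is at most
  \<open>exp ((m + 1)/2)\<close>, without any factor depending on the sample size
  (\<open>fair_signs_exp_square_sum\<close>). A neighbourhood is the set of observations no farther away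
  than some observation, hence a union bound costs only a factor \<open>n\<close>, and the threshold
  \<open>(d + 3) ln n\<close> leaves a probability of order \<open>n powr (- (d + 2))\<close>.

  \<^item> The neighbourhood made of all observations in the ball has a right signal above the threshold
  (\<open>prob_weak_signal\<close>). One population suffices for this, and since a normalised square dominates
  a tangent linear function, the estimate is a single Chernoff bound. It gives probability
  \<open>1/n\<^sup>2\<close> once some population satisfies \<open>N\<^sub>g \<zeta> powr ((2 \<gamma>\<^sub>g \<beta> + d)/\<beta>) \<ge> A\<^sub>g ln n\<close>, and this holds as
  soon as \<open>\<zeta> \<ge> t\<close> with \<open>t\<close> a multiple of \<open>S powr (- \<beta>/(2 \<beta> + d))\<close>, where \<open>S\<close> is the bracket in the
  rate (\<open>exists_informative_sample\<close>).

  On these events the stopping rule stops inside the ball, with a signal that can only be right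
  (\<open>classifier_correct\<close>). The points with \<open>\<zeta> < t\<close> contribute at most
  \<open>2 t C\<alpha> t powr \<alpha>\<close> to the excess risk, which is the claimed rate; the other points contribute a multiple
  of \<open>1/n\<^sup>2\<close>, and \<open>\<alpha> \<beta> \<le> d\<close> makes this no larger than the rate (\<open>inverse_square_le_rate\<close>).
\<close>

section \<open>Normalised squares of fair coin sums\<close>

lemma cosh_le_exp_half_square: "cosh (x::real) \<le> exp (x\<^sup>2 / 2)"
proof -
  have a: "(\<lambda>k. if even k then x ^ k /\<^sub>R fact k else 0) sums cosh x"
    by (rule cosh_converges)
  have inj: "strict_mono (\<lambda>k::nat. 2 * k)" by (simp add: strict_mono_def)
  have "(\<lambda>k. x ^ (2 * k) /\<^sub>R fact (2 * k)) sums cosh x"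
    using sums_mono_reindex[OF inj, of "\<lambda>k. if even k then x ^ k /\<^sub>R fact k else 0" "cosh x"] a
    by (force elim: evenE)
  moreover have "(\<lambda>k. (x\<^sup>2 / 2) ^ k /\<^sub>R fact k) sums exp (x\<^sup>2 / 2)"
    by (rule exp_converges)
  moreover have "x ^ (2 * k) /\<^sub>R fact (2 * k) \<le> (x\<^sup>2 / 2) ^ k /\<^sub>R fact k" for k
  proof -
    have f: "fact k * 2 ^ k \<le> (fact (2 * k) :: real)"
    proof (induction k)
      case (Suc k)
      have "fact (Suc k) * 2 ^ Suc k = (2 * real k + 2) * (fact k * 2 ^ k :: real)"
        by (simp add: algebra_simps)
      also have "\<dots> \<le> (2 * real k + 2) * fact (2 * k)"
        using Suc by (intro mult_left_mono) auto
      also have "\<dots> \<le> (2 * real k + 2) * ((2 * real k + 1) * fact (2 * k))"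
        by (intro mult_left_mono) (auto simp: mult_le_cancel_right1)
      also have "\<dots> = fact (2 * Suc k)" by (simp add: algebra_simps)
      finally show ?case .
    qed simp
    have "x ^ (2 * k) / fact (2 * k) \<le> x ^ (2 * k) / (fact k * 2 ^ k)"
      using f by (intro divide_left_mono) simp_all
    then show ?thesis
      by (simp add: power_mult power_divide divide_simps)
  qed
  ultimately show ?thesis by (rule sums_le[rotated -1, rotated -1]) 
qed

text \<open>
  The coins are revealed one at a time. Averaging over one coin of population \<open>g\<close> turns the square
  \<open>W\<^sup>2/t\<close> into at most \<open>1/t + W\<^sup>2 (1/t + 2/t\<^sup>2)\<close>, because \<open>cosh y \<le> exp (y\<^sup>2/2)\<close>, and
  \<open>1/t + 2/t\<^sup>2 \<le> 1/(t - 2)\<close>. Each coin thus lowers the normaliser of its population by \<open>2\<close>,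
  which a normaliser of at least \<open>2 N + u\<close> survives for all \<open>N\<close> coins, and costs a factor at most
  \<open>exp (1/u)\<close>. The normalisers are arbitrary in the statement so that the induction can change them.
\<close>
lemma fair_signs_exp_square_sum:
  fixes grp :: "'a \<Rightarrow> 'g::finite" and t u :: "'g \<Rightarrow> real"
  assumes "finite J"
    and "\<And>g. u g > 0" "\<And>g. t g \<ge> 2 * real (card {a \<in> J. a \<in> A \<and> grp a = g}) + u g"
  shows "(\<Sum>S\<in>Pow J. exp (\<Sum>g\<in>UNIV. (\<Sum>a | a \<in> J \<and> a \<in> A \<and> grp a = g. if a \<in> S then 1 else - 1)\<^sup>2 / t g))
         \<le> 2 ^ card J * exp (\<Sum>g\<in>UNIV. real (card {a \<in> J. a \<in> A \<and> grp a = g}) / u g)"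
  using assms(1,3)
proof (induction J arbitrary: t rule: finite_induct)
  case empty
  then show ?case by simp
next
  case (insert b J)
  define W where "W = (\<lambda>S g. \<Sum>a | a \<in> J \<and> a \<in> A \<and> grp a = g. if a \<in> S then 1 else - 1 :: real)"
  define W' where "W' = (\<lambda>S g. \<Sum>a | a \<in> insert b J \<and> a \<in> A \<and> grp a = g. if a \<in> S then 1 else - 1 :: real)"
  define N where "N = (\<lambda>J g. real (card {a \<in> J. a \<in> A \<and> grp a = g}))"
  have split: "(\<Sum>S\<in>Pow (insert b J). f S) = (\<Sum>S\<in>Pow J. f S + f (insert b S))" for f :: "'a set \<Rightarrow> real"
  proof -
    have "Pow (insert b J) = Pow J \<union> insert b ` Pow J" by (rule Pow_insert)
    moreover have "Pow J \<inter> insert b ` Pow J = {}" using insert by auto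
    moreover have "inj_on (insert b) (Pow J)"
      using insert(2) by (intro inj_onI) (metis Diff_insert_absorb PowD subsetD)
    ultimately show ?thesis using insert(1)
      by (simp add: sum.union_disjoint sum.reindex sum.distrib)
  qed
  show ?case
  proof (cases "b \<in> A")
    case False
    have s: "{a. a \<in> insert b J \<and> a \<in> A \<and> grp a = g} = {a. a \<in> J \<and> a \<in> A \<and> grp a = g}" for g
      using False by auto
    have W1: "W (insert b S) g = W S g" for S g
      unfolding W_def using insert(2) by (intro sum.cong) auto
    have "(\<Sum>S\<in>Pow (insert b J). exp (\<Sum>g\<in>UNIV. (W' S g)\<^sup>2 / t g)) = 2 * (\<Sum>S\<in>Pow J. exp (\<Sum>g\<in>UNIV. (W S g)\<^sup>2 / t g))"
      unfolding split W'_def s W_def[symmetric] W1 by (simp add: sum_distrib_left)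
    also have "\<dots> \<le> 2 * (2 ^ card J * exp (\<Sum>g\<in>UNIV. N J g / u g))"
      unfolding W_def N_def using insert(4) s by (intro mult_left_mono insert(3)) auto
    also have "\<dots> = 2 ^ card (insert b J) * exp (\<Sum>g\<in>UNIV. N (insert b J) g / u g)"
      using insert(1,2) s unfolding N_def by simp
    finally show ?thesis unfolding W'_def N_def .
  next
    case True
    define g0 where "g0 = grp b"
    define t' where "t' = t(g0 := t g0 - 2)"
    have s: "{a. a \<in> insert b J \<and> a \<in> A \<and> grp a = g} = (if g = g0 then insert b else id) {a. a \<in> J \<and> a \<in> A \<and> grp a = g}" for g
      using True by (auto simp: g0_def)
    have N': "N (insert b J) g = N J g + of_bool (g = g0)" for g
      unfolding N_def s using insert(1,2) by auto
    have W1: "W (insert b S) g = W S g" for S g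
      unfolding W_def using insert(2) by (intro sum.cong) auto
    have W2: "W' S g = W S g + (if g = g0 then (if b \<in> S then 1 else - 1) else 0)" for S g
      unfolding W'_def s W_def using insert(1,2) by (auto simp: sum.insert)
    have t2: "t g0 \<ge> 2 + u g0" using insert(4)[of g0] N'[of g0] unfolding N_def by simp
    have step: "exp (\<Sum>g\<in>UNIV. (W' S g)\<^sup>2 / t g) + exp (\<Sum>g\<in>UNIV. (W' (insert b S) g)\<^sup>2 / t g)
        \<le> 2 * exp (1 / u g0) * exp (\<Sum>g\<in>UNIV. (W S g)\<^sup>2 / t' g)" if "S \<subseteq> J" for S
    proof -
      define R where "R = (\<Sum>g\<in>UNIV - {g0}. (W S g)\<^sup>2 / t g)"
      define w where "w = W S g0"
      define T where "T = t g0"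
      have bS: "b \<notin> S" using that insert(2) by auto
      have rm: "(\<Sum>g\<in>UNIV. f g) = f g0 + (\<Sum>g\<in>UNIV - {g0}. f g)" for f :: "'g \<Rightarrow> real"
        by (rule sum.remove) auto
      have e1: "(\<Sum>g\<in>UNIV. (W' S g)\<^sup>2 / t g) = (w - 1)\<^sup>2 / T + R"
        unfolding rm R_def w_def T_def W2 using bS by (auto intro: sum.cong)
      have e2: "(\<Sum>g\<in>UNIV. (W' (insert b S) g)\<^sup>2 / t g) = (w + 1)\<^sup>2 / T + R"
        unfolding rm R_def w_def T_def W2 W1 by (auto intro: sum.cong)
      have e3: "(\<Sum>g\<in>UNIV. (W S g)\<^sup>2 / t' g) = w\<^sup>2 / (T - 2) + R"
        unfolding rm R_def w_def T_def t'_def by (auto intro: sum.cong)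
      have T: "T > 2" "T \<ge> u g0" using t2 assms(2)[of g0] by (auto simp: T_def)
      have "exp ((w - 1)\<^sup>2 / T) + exp ((w + 1)\<^sup>2 / T) = 2 * exp (w\<^sup>2 / T + 1 / T) * cosh (2 * w / T)"
        unfolding cosh_def scaleR_conv_of_real
        by (simp add: field_simps power2_eq_square flip: exp_add) (simp add: add_divide_distrib diff_divide_distrib)
      also have "\<dots> \<le> 2 * exp (w\<^sup>2 / T + 1 / T) * exp ((2 * w / T)\<^sup>2 / 2)"
        by (intro mult_left_mono cosh_le_exp_half_square) auto
      also have "\<dots> = 2 * exp (1 / T) * exp (w\<^sup>2 * (1 / T + 2 / T\<^sup>2))"
        by (simp add: exp_add[symmetric] power_divide algebra_simps power2_eq_square)
      also have "\<dots> \<le> 2 * exp (1 / u g0) * exp (w\<^sup>2 * (1 / (T - 2)))"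
      proof -
        have "1 / T + 2 / T\<^sup>2 = (T\<^sup>2 - 4) / (T\<^sup>2 * (T - 2))"
          using T by (simp add: field_simps power2_eq_square)
        also have "\<dots> \<le> T\<^sup>2 / (T\<^sup>2 * (T - 2))" using T by (intro divide_right_mono) auto
        also have "\<dots> = 1 / (T - 2)" using T by simp
        finally have q: "1 / T + 2 / T\<^sup>2 \<le> 1 / (T - 2)" .
        have "1 / T \<le> 1 / u g0" using T assms(2)[of g0] by (intro divide_left_mono) auto
        then have e: "exp (1 / T) \<le> exp (1 / u g0)" by simp
        have "exp (w\<^sup>2 * (1 / T + 2 / T\<^sup>2)) \<le> exp (w\<^sup>2 * (1 / (T - 2)))"
          using mult_left_mono[OF q, of "w\<^sup>2"] by (subst exp_le_cancel_iff) auto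
        with e show ?thesis by (intro mult_mono) auto
      qed
      finally have "(exp ((w - 1)\<^sup>2 / T) + exp ((w + 1)\<^sup>2 / T)) * exp R \<le> 2 * exp (1 / u g0) * exp (w\<^sup>2 / (T - 2)) * exp R"
        by (intro mult_right_mono) auto
      then show ?thesis unfolding e1 e2 e3 by (simp add: exp_add algebra_simps)
    qed
    have "(\<Sum>S\<in>Pow (insert b J). exp (\<Sum>g\<in>UNIV. (W' S g)\<^sup>2 / t g)) \<le> (\<Sum>S\<in>Pow J. 2 * exp (1 / u g0) * exp (\<Sum>g\<in>UNIV. (W S g)\<^sup>2 / t' g))"
      unfolding split using step by (intro sum_mono) auto
    also have "\<dots> = 2 * exp (1 / u g0) * (\<Sum>S\<in>Pow J. exp (\<Sum>g\<in>UNIV. (W S g)\<^sup>2 / t' g))"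
      by (simp add: sum_distrib_left)
    also have "\<dots> \<le> 2 * exp (1 / u g0) * (2 ^ card J * exp (\<Sum>g\<in>UNIV. N J g / u g))"
      unfolding W_def N_def
    proof (intro mult_left_mono insert(3))
      fix g
      show "2 * real (card {a \<in> J. a \<in> A \<and> grp a = g}) + u g \<le> t' g"
        using insert(4)[of g] N'[of g] unfolding N_def t'_def by (auto split: if_splits)
    qed auto
    also have "\<dots> = 2 ^ card (insert b J) * exp (\<Sum>g\<in>UNIV. N (insert b J) g / u g)"
    proof -
      have "(\<Sum>g\<in>UNIV. N (insert b J) g / u g) = (\<Sum>g\<in>UNIV. N J g / u g + of_bool (g = g0) / u g)"
        unfolding N' by (simp add: add_divide_distrib)
      also have "\<dots> = (\<Sum>g\<in>UNIV. N J g / u g) + (\<Sum>g\<in>UNIV. if g = g0 then 1 / u g0 else 0)"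
        unfolding sum.distrib by (intro arg_cong2[of _ _ _ _ "(+)"] sum.cong) auto
      also have "\<dots> = (\<Sum>g\<in>UNIV. N J g / u g) + 1 / u g0" by simp
      finally show ?thesis using insert(1,2) by (simp add: exp_add)
    qed
    finally show ?thesis unfolding W'_def N_def .
  qed
qed

text \<open>
  The accumulated evidence of the observations in \<open>A\<close> for the label favoured by the direction \<open>s\<close>:
  since \<open>k (q - 1/2)\<^sup>2\<close> is the square of \<open>k (q - 1/2)\<close> divided by \<open>k\<close>, the statistics \<open>r_plus\<close> and
  \<open>r_minus\<close> are the cases \<open>s = 1\<close> and \<open>s = - 1\<close>. Treating both at once halves all later arguments.
\<close>
definition directed_signal :: "real \<Rightarrow> ('g::finite \<times> 'j) set \<Rightarrow> ('g \<times> 'j \<Rightarrow> bool) \<Rightarrow> real" where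
  "directed_signal s A y = (\<Sum>g\<in>UNIV.
     (max 0 (s * (\<Sum>a | a \<in> A \<and> fst a = g. of_bool (y a) - 1/2)))\<^sup>2 / real (card {a \<in> A. fst a = g}))"

text \<open>
  A population with \<open>N\<close> coins is given the normaliser \<open>4 N\<close>, since a sum of labels centred at \<open>1/2\<close>
  is half a sum of signs. With \<open>u = 2 N\<close> the exponential moment costs \<open>exp (1/2)\<close> for each population,
  whatever its size, and Markov's inequality gives the rest.
\<close>
lemma fair_labels_tail:
  fixes A :: "('g::finite \<times> 'j) set"
  assumes "finite I" "A \<subseteq> I" "\<bar>s\<bar> = 1"
  shows "real (card {S \<in> Pow I. directed_signal s A (\<lambda>a. a \<in> S) > L})
         \<le> 2 ^ card I * exp (real CARD('g) / 2 - L)"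
proof -
  define N where "N = (\<lambda>g. card {a \<in> A. fst a = g})"
  \<comment> \<open>A population absent from \<open>A\<close> has signal \<open>0\<close>; any positive normaliser serves for it.\<close>
  define t where "t = (\<lambda>g. if N g = 0 then 1 else 4 * real (N g))"
  define u where "u = (\<lambda>g. if N g = 0 then 1 else 2 * real (N g))"
  define W where "W = (\<lambda>S g. \<Sum>a | a \<in> I \<and> a \<in> A \<and> fst a = g. if a \<in> S then 1 else - 1 :: real)"
  have [simp]: "finite A" using assms finite_subset by auto
  have Ng: "card {a \<in> A. fst a = g} = N g" for g by (simp add: N_def)
  have s: "{a. a \<in> I \<and> a \<in> A \<and> fst a = g} = {a. a \<in> A \<and> fst a = g}" for g using assms by auto
  have le: "directed_signal s A (\<lambda>a. a \<in> S) \<le> (\<Sum>g\<in>UNIV. (W S g)\<^sup>2 / t g)" for S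
    unfolding directed_signal_def
  proof (rule sum_mono)
    fix g
    define w where "w = (\<Sum>a | a \<in> A \<and> fst a = g. of_bool (a \<in> S) - 1/2 :: real)"
    have W: "W S g = 2 * w" unfolding W_def s w_def sum_distrib_left by (intro sum.cong) auto
    have "\<bar>max 0 (s * w)\<bar> \<le> \<bar>w\<bar>" using assms(3) by (auto simp: max_def abs_if split: if_splits)
    then have "(max 0 (s * w))\<^sup>2 \<le> w\<^sup>2" by (rule abs_le_square_iff[THEN iffD1])
    then have "(max 0 (s * w))\<^sup>2 / real (N g) \<le> w\<^sup>2 / real (N g)" by (intro divide_right_mono) auto
    also have "\<dots> \<le> (W S g)\<^sup>2 / t g" unfolding W t_def by (auto simp: field_simps)
    finally show "(max 0 (s * w))\<^sup>2 / real (card {a \<in> A. fst a = g}) \<le> (W S g)\<^sup>2 / t g" unfolding N_def .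
  qed
  have "real (card {S \<in> Pow I. directed_signal s A (\<lambda>a. a \<in> S) > L})
     = (\<Sum>S\<in>Pow I. of_bool (directed_signal s A (\<lambda>a. a \<in> S) > L))"
    using assms(1) by (subst sum_of_bool_eq) (auto intro: arg_cong[where f = card])
  also have "\<dots> \<le> (\<Sum>S\<in>Pow I. exp (- L) * exp (\<Sum>g\<in>UNIV. (W S g)\<^sup>2 / t g))"
  proof (rule sum_mono)
    fix S
    show "of_bool (directed_signal s A (\<lambda>a. a \<in> S) > L) \<le> exp (- L) * exp (\<Sum>g\<in>UNIV. (W S g)\<^sup>2 / t g)"
      using le[of S] by (auto simp: exp_add[symmetric])
  qed
  also have "\<dots> = exp (- L) * (\<Sum>S\<in>Pow I. exp (\<Sum>g\<in>UNIV. (W S g)\<^sup>2 / t g))" by (simp add: sum_distrib_left)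
  also have "\<dots> \<le> exp (- L) * (2 ^ card I * exp (\<Sum>g\<in>UNIV. real (card {a \<in> I. a \<in> A \<and> fst a = g}) / u g))"
    unfolding W_def using assms(1)
    by (intro mult_left_mono fair_signs_exp_square_sum) (auto simp: u_def t_def s Ng)
  also have "\<dots> \<le> exp (- L) * (2 ^ card I * exp (\<Sum>g\<in>(UNIV::'g set). 1 / 2))"
    by (intro mult_left_mono exp_le_cancel_iff[THEN iffD2] sum_mono) (auto simp: u_def s Ng)
  also have "\<dots> = 2 ^ card I * exp (real CARD('g) / 2 - L)"
    using exp_add[of "- L" "real CARD('g) / 2"] by simp
  finally show ?thesis .
qed

lemma directed_signal_antimono:
  assumes "finite A" "\<And>a. a \<in> A \<Longrightarrow> s * of_bool (y a) \<le> s * of_bool (y' a)"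
  shows "directed_signal s A y \<le> directed_signal s A y'"
  unfolding directed_signal_def
proof (intro sum_mono divide_right_mono power_mono max.mono)
  fix g
  show "s * (\<Sum>a | a \<in> A \<and> fst a = g. of_bool (y a) - 1/2) \<le> s * (\<Sum>a | a \<in> A \<and> fst a = g. of_bool (y' a) - 1/2)"
    unfolding sum_distrib_left using assms(2) by (intro sum_mono) (auto simp: algebra_simps)
qed auto

text \<open>
  The tangent bound \<open>w\<^sup>2/N \<ge> 2 h w - h\<^sup>2 N\<close>: it turns the self-normalised signal into a sum of
  independent terms, one for each observation of a single population.
\<close>
lemma directed_signal_ge_linear:
  fixes A :: "('g::finite \<times> 'j) set"
  assumes "finite A" "h \<ge> 0"
  shows "(\<Sum>a | a \<in> A \<and> fst a = g. 2 * h * (s * (of_bool (y a) - 1/2)) - h\<^sup>2) \<le> directed_signal s A y"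
proof -
  define w where "w = s * (\<Sum>a | a \<in> A \<and> fst a = g. of_bool (y a) - 1/2 :: real)"
  define N where "N = real (card {a \<in> A. fst a = g})"
  have fin: "finite {a \<in> A. fst a = g}" using assms by simp
  have "(\<Sum>a | a \<in> A \<and> fst a = g. 2 * h * (s * (of_bool (y a) - 1/2)) - h\<^sup>2) = 2 * h * w - h\<^sup>2 * N"
    unfolding w_def N_def by (simp add: sum_subtractf sum_distrib_left algebra_simps)
  also have "\<dots> \<le> 2 * h * max 0 w - h\<^sup>2 * N" using assms by (auto intro: mult_left_mono)
  also have "\<dots> \<le> (max 0 w)\<^sup>2 / N"
  proof (cases "N = 0")
    case True
    then have "{a \<in> A. fst a = g} = {}" using fin unfolding N_def by simp
    then have "w = 0" unfolding w_def by (metis mult_zero_right sum.empty)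
    then show ?thesis using True by simp
  next
    case False
    then have N: "N > 0" by (simp add: N_def)
    have "0 \<le> (max 0 w - h * N)\<^sup>2 / N" using N by simp
    also have "\<dots> = (max 0 w)\<^sup>2 / N - 2 * h * max 0 w + h\<^sup>2 * N"
      using N by (simp add: field_simps power2_eq_square)
    finally show ?thesis by simp
  qed
  also have "\<dots> \<le> directed_signal s A y"
    unfolding directed_signal_def w_def N_def by (rule member_le_sum) auto
  finally show ?thesis .
qed

section \<open>Populations and conditional label laws\<close>

lemma closed_msupport: "closed (msupport M)"
proof -
  have "- msupport M = \<Union> {U. open U \<and> \<not> emeasure M U > 0}"
    unfolding msupport_def by auto
  then show ?thesis unfolding closed_def by (metis (no_types, lifting) mem_Collect_eq open_Union)
qed

text \<open>
  Every point outside the support has an open null neighbourhood, and in a second countable space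
  countably many of these cover the complement.
\<close>
lemma AE_in_msupport:
  fixes M :: "'a::second_countable_topology measure"
  assumes "sets M = sets borel"
  shows "AE x in M. x \<in> msupport M"
proof -
  let ?\<U> = "{U. open U \<and> emeasure M U = 0}"
  have eq: "- msupport M = \<Union> ?\<U>"
    unfolding msupport_def by (auto simp: zero_less_iff_neq_zero)
  obtain \<V> where \<V>: "\<V> \<subseteq> ?\<U>" "countable \<V>" "\<Union> \<V> = \<Union> ?\<U>"
    by (rule Lindelof[of ?\<U>]) auto
  have "(\<Union>U\<in>\<V>. U) \<in> null_sets M"
    using \<V> assms by (intro null_sets_UN') (auto simp: null_sets_def)
  then have "- msupport M \<in> null_sets M" using eq \<V> by simp
  then show ?thesis by (rule AE_I') auto
qed

lemma population_D:
  assumes "population G"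
  shows "prob_space G" "sets G = sets (borel \<Otimes>\<^sub>M count_space UNIV)" "space G = UNIV"
    "prob_space (covariate_law G)" "sets (covariate_law G) = sets borel" "space (covariate_law G) = UNIV"
    "fst \<in> G \<rightarrow>\<^sub>M borel" "snd \<in> G \<rightarrow>\<^sub>M count_space UNIV"
proof -
  show p: "prob_space G" and s: "sets G = sets (borel \<Otimes>\<^sub>M count_space UNIV)"
    using assms unfolding population_def obs_space_def by auto
  show "space G = UNIV" using sets_eq_imp_space_eq[OF s] by (simp add: space_pair_measure)
  show f: "fst \<in> G \<rightarrow>\<^sub>M borel" and "snd \<in> G \<rightarrow>\<^sub>M count_space UNIV"
    unfolding measurable_cong_sets[OF s refl] by auto
  show "prob_space (covariate_law G)" unfolding covariate_law_def by (rule prob_space.prob_space_distr[OF p f])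
  show "sets (covariate_law G) = sets borel" "space (covariate_law G) = UNIV"
    unfolding covariate_law_def by auto
qed

lemma regression_functionD:
  assumes "regression_function G \<eta>"
  shows "\<eta> \<in> borel_measurable borel" "0 \<le> \<eta> x" "\<eta> x \<le> 1"
    "A \<in> sets borel \<Longrightarrow> measure G (A \<times> {True}) = (LINT x:A|covariate_law G. \<eta> x)"
    "x \<notin> msupport (covariate_law G) \<Longrightarrow> \<eta> x = 1/2"
  using assms unfolding regression_function_def by auto

text \<open>
  The label is drawn from its conditional law given the covariate. Only the measure of the rectangles
  \<open>A \<times> {True}\<close> is prescribed by the regression function; it identifies the sub-probability laws of
  the covariate on each of the two label events as densities with respect to the covariate law.
\<close>
lemma nn_integral_population:
  fixes G :: "((real^'d) \<times> bool) measure"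
  assumes G: "population G" and \<eta>: "regression_function G \<eta>"
    and F: "F \<in> borel_measurable G"
  shows "(\<integral>\<^sup>+ z. F z \<partial>G) =
    (\<integral>\<^sup>+ x. ennreal (\<eta> x) * F (x, True) + ennreal (1 - \<eta> x) * F (x, False) \<partial>covariate_law G)"
proof -
  interpret G: prob_space G by (rule population_D[OF G])
  define H where "H = covariate_law G"
  interpret H: prob_space H unfolding H_def by (rule population_D[OF G])
  note sG = population_D(2)[OF G]
  have sH [measurable_cong]: "sets H = sets borel" unfolding H_def by (rule population_D[OF G])
  have \<eta>m [measurable]: "\<eta> \<in> borel_measurable borel" by (rule regression_functionD[OF \<eta>])
  note \<eta>01 = regression_functionD(2,3)[OF \<eta>]
  have Fm [measurable]: "F \<in> borel_measurable (borel \<Otimes>\<^sub>M count_space UNIV)"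
    using F unfolding measurable_cong_sets[OF sG refl] .
  have Fb [measurable]: "(\<lambda>x. F (x, b)) \<in> borel_measurable borel" for b by measurable
  have fstG [measurable]: "fst \<in> G \<rightarrow>\<^sub>M borel" and sndG [measurable]: "snd \<in> G \<rightarrow>\<^sub>M count_space UNIV"
    by (rule population_D[OF G])+
  have FG [measurable]: "F \<in> borel_measurable G" by (rule F)
  have rect: "A \<times> {b} \<in> sets G" if "A \<in> sets borel" for A b
    unfolding sG using that by auto
  define h where "h = (\<lambda>b x. if b then \<eta> x else 1 - \<eta> x)"
  have hm [measurable]: "h b \<in> borel_measurable borel" for b unfolding h_def by (cases b) auto
  have h0: "0 \<le> h b x" "h b x \<le> 1" for b x using \<eta>01[of x] by (auto simp: h_def)
  have inth: "integrable H (h b)" for b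
    by (rule H.integrable_const_bound[where B = 1]) (use h0 in auto)
  have mH: "measure H A = measure G (A \<times> UNIV)" if "A \<in> sets borel" for A
  proof -
    have "fst -` A \<inter> space G = A \<times> UNIV" unfolding population_D(3)[OF G] by auto
    then show ?thesis unfolding H_def covariate_law_def using that by (subst measure_distr) auto
  qed
  have rec: "measure G (A \<times> {b}) = (LINT x:A|H. h b x)" if A: "A \<in> sets borel" for A b
  proof (cases b)
    case True
    then show ?thesis using regression_functionD(4)[OF \<eta> A] by (simp add: h_def H_def)
  next
    case False
    have AH: "A \<in> sets H" using A sH by simp
    have "measure G (A \<times> UNIV) = measure G (A \<times> {True}) + measure G (A \<times> {False})"
      by (subst G.finite_measure_Union[symmetric]) (use A rect in \<open>auto simp: UNIV_bool intro!: arg_cong[where f = "measure G"]\<close>)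
    moreover have "(LINT x:A|H. h False x) = measure H A - (LINT x:A|H. \<eta> x)"
    proof -
      have i1: "integrable H (\<lambda>x. indicator A x *\<^sub>R (1::real))"
        using AH by (auto intro!: H.integrable_const_bound[where B = 1] simp: indicator_def)
      have i2: "integrable H (\<lambda>x. indicator A x *\<^sub>R \<eta> x)"
        using AH \<eta>01 by (auto intro!: H.integrable_const_bound[where B = 1] simp: indicator_def)
      have "(LINT x:A|H. h False x) = (LINT x|H. indicator A x *\<^sub>R 1 - indicator A x *\<^sub>R \<eta> x)"
        unfolding set_lebesgue_integral_def by (intro Bochner_Integration.integral_cong) (auto simp: h_def indicator_def)
      also have "\<dots> = measure H A - (LINT x:A|H. \<eta> x)"
        using i1 i2 AH by (subst Bochner_Integration.integral_diff) (auto simp: set_lebesgue_integral_def)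
      finally show ?thesis .
    qed
    ultimately show ?thesis using regression_functionD(4)[OF \<eta> A] mH[OF A] False
      by (simp add: H_def)
  qed
  have part: "(\<integral>\<^sup>+ z. F z * indicator (UNIV \<times> {b}) z \<partial>G) = (\<integral>\<^sup>+ x. ennreal (h b x) * F (x, b) \<partial>H)" for b
  proof -
    have ind [measurable]: "(\<lambda>z. indicator (UNIV \<times> {b}) z :: ennreal) \<in> borel_measurable G"
      using rect[of UNIV b] by simp
    have law: "distr (density G (indicator (UNIV \<times> {b}))) borel fst = density H (\<lambda>x. ennreal (h b x))"
    proof (rule measure_eqI)
      fix A assume "A \<in> sets (distr (density G (indicator (UNIV \<times> {b}))) borel fst)"
      then have A [measurable]: "A \<in> sets borel" by simp
      have AH: "A \<in> sets H" using A sH by simp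
      have "emeasure (distr (density G (indicator (UNIV \<times> {b}))) borel fst) A
          = emeasure (density G (indicator (UNIV \<times> {b}))) (A \<times> UNIV)"
        by (subst emeasure_distr) (auto simp: population_D(3)[OF G] intro!: arg_cong2[where f = emeasure])
      also have "\<dots> = (\<integral>\<^sup>+ z. indicator (A \<times> {b}) z \<partial>G)"
      proof (subst emeasure_density)
        show "A \<times> UNIV \<in> sets G" unfolding sG using A by auto
        show "(\<integral>\<^sup>+ z. indicator (UNIV \<times> {b}) z * indicator (A \<times> UNIV) z \<partial>G) = (\<integral>\<^sup>+ z. indicator (A \<times> {b}) z \<partial>G)"
          by (rule nn_integral_cong) (auto simp: indicator_def)
      qed (rule ind)
      also have "\<dots> = ennreal (measure G (A \<times> {b}))"
        using rect[OF A] by (simp add: G.emeasure_eq_measure)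
      also have "\<dots> = ennreal (LINT x|H. indicator A x *\<^sub>R h b x)"
        unfolding rec[OF A] set_lebesgue_integral_def ..
      also have "\<dots> = (\<integral>\<^sup>+ x. ennreal (indicator A x *\<^sub>R h b x) \<partial>H)"
        using inth[of b] AH h0 by (intro nn_integral_eq_integral[symmetric] integrable_mult_indicator) (auto simp: indicator_def)
      also have "\<dots> = emeasure (density H (\<lambda>x. ennreal (h b x))) A"
        using AH by (subst emeasure_density) (auto intro!: nn_integral_cong simp: indicator_def)
      finally show "emeasure (distr (density G (indicator (UNIV \<times> {b}))) borel fst) A
          = emeasure (density H (\<lambda>x. ennreal (h b x))) A" .
    qed (simp add: sH)
    have "(\<integral>\<^sup>+ z. F z * indicator (UNIV \<times> {b}) z \<partial>G) = (\<integral>\<^sup>+ z. indicator (UNIV \<times> {b}) z * F (fst z, b) \<partial>G)"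
      by (intro nn_integral_cong) (auto simp: indicator_def)
    also have "\<dots> = (\<integral>\<^sup>+ z. F (fst z, b) \<partial>density G (indicator (UNIV \<times> {b})))"
      by (subst nn_integral_density) auto
    also have "\<dots> = (\<integral>\<^sup>+ x. F (x, b) \<partial>distr (density G (indicator (UNIV \<times> {b}))) borel fst)"
      by (subst nn_integral_distr) auto
    also have "\<dots> = (\<integral>\<^sup>+ x. ennreal (h b x) * F (x, b) \<partial>H)"
      unfolding law by (subst nn_integral_density) auto
    finally show ?thesis .
  qed
  have "(\<integral>\<^sup>+ z. F z \<partial>G) = (\<integral>\<^sup>+ z. F z * indicator (UNIV \<times> {True}) z + F z * indicator (UNIV \<times> {False}) z \<partial>G)"
    by (intro nn_integral_cong) (auto simp: indicator_def)
  also have "\<dots> = (\<integral>\<^sup>+ z. F z * indicator (UNIV \<times> {True}) z \<partial>G) + (\<integral>\<^sup>+ z. F z * indicator (UNIV \<times> {False}) z \<partial>G)"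
    using rect[of UNIV] by (intro nn_integral_add) auto
  also have "\<dots> = (\<integral>\<^sup>+ x. ennreal (h True x) * F (x, True) + ennreal (h False x) * F (x, False) \<partial>H)"
    unfolding part by (intro nn_integral_add[symmetric]) auto
  finally show ?thesis unfolding H_def h_def by simp
qed

lemma nn_integral_covariate_law:
  assumes "population G" "f \<in> borel_measurable borel"
  shows "(\<integral>\<^sup>+ z. f (fst z) \<partial>G) = (\<integral>\<^sup>+ x. f x \<partial>covariate_law G)"
  unfolding covariate_law_def using assms population_D(7)[OF assms(1)]
  by (subst nn_integral_distr) auto

text \<open>
  If an integrand does not increase when the label moves to the side that is more likely under the
  conditional law, then making the label fair only moves mass towards larger values.
\<close>
lemma nn_integral_le_fair_label:
  fixes G :: "((real^'d) \<times> bool) measure"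
  assumes G: "population G" and \<eta>: "regression_function G \<eta>"
    and F: "F \<in> borel_measurable G"
    and up: "\<And>x. \<eta> x > 1/2 \<Longrightarrow> F (x, True) \<le> F (x, False)"
    and down: "\<And>x. \<eta> x < 1/2 \<Longrightarrow> F (x, False) \<le> F (x, True)"
  shows "(\<integral>\<^sup>+ z. F z \<partial>G) \<le> (\<integral>\<^sup>+ z. ennreal (1/2) * (F (fst z, True) + F (fst z, False)) \<partial>G)"
proof -
  have Fm [measurable]: "F \<in> borel_measurable (borel \<Otimes>\<^sub>M count_space UNIV)"
    using F unfolding measurable_cong_sets[OF population_D(2)[OF G] refl] .
  have Fb [measurable]: "(\<lambda>x. F (x, b)) \<in> borel_measurable borel" for b by measurable
  have mix: "ennreal (1 - q) * a + ennreal q * b \<le> ennreal (1/2) * (a + b)"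
    if "b \<le> a" "q \<ge> 1/2" "q \<le> 1" for q and a b :: ennreal
  proof -
    from that(1) obtain c where a: "a = b + c" by (metis le_iff_add)
    have "ennreal (1 - q) * a + ennreal q * b = (ennreal (1 - q) + ennreal q) * b + ennreal (1 - q) * c"
      unfolding a by (simp add: algebra_simps)
    also have "ennreal (1 - q) + ennreal q = 1" using that by (simp flip: ennreal_plus)
    also have "1 * b + ennreal (1 - q) * c \<le> 1 * b + ennreal (1/2) * c"
      using that by (intro add_left_mono mult_right_mono ennreal_leI) auto
    also have "1 = ennreal (1/2) + ennreal (1/2)" by (subst ennreal_plus[symmetric]) auto
    also have "(ennreal (1/2) + ennreal (1/2)) * b + ennreal (1/2) * c = ennreal (1/2) * (a + b)"
      unfolding a by (simp add: algebra_simps)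
    finally show ?thesis .
  qed
  have "(\<integral>\<^sup>+ z. F z \<partial>G) = (\<integral>\<^sup>+ x. ennreal (\<eta> x) * F (x, True) + ennreal (1 - \<eta> x) * F (x, False) \<partial>covariate_law G)"
    by (rule nn_integral_population[OF G \<eta> F])
  also have "\<dots> \<le> (\<integral>\<^sup>+ x. ennreal (1/2) * (F (x, True) + F (x, False)) \<partial>covariate_law G)"
  proof (rule nn_integral_mono)
    fix x
    show "ennreal (\<eta> x) * F (x, True) + ennreal (1 - \<eta> x) * F (x, False) \<le> ennreal (1/2) * (F (x, True) + F (x, False))"
    proof (cases "\<eta> x" "1/2 :: real" rule: linorder_cases)
      case equal
      then have e: "\<eta> x = 1/2" "1 - \<eta> x = 1/2" by auto
      show ?thesis unfolding e(2) unfolding e(1) distrib_left by (rule order_refl)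
    next
      case less
      then show ?thesis using mix[of "F (x, False)" "F (x, True)" "1 - \<eta> x"] down[of x] regression_functionD(2)[OF \<eta>, of x] by simp
    next
      case greater
      then show ?thesis using mix[of "F (x, True)" "F (x, False)" "\<eta> x"] up[of x] regression_functionD(3)[OF \<eta>, of x]
        by (simp add: add.commute)
    qed
  qed
  also have "\<dots> = (\<integral>\<^sup>+ z. ennreal (1/2) * (F (fst z, True) + F (fst z, False)) \<partial>G)"
    by (rule nn_integral_covariate_law[OF G, symmetric]) measurable
  finally show ?thesis .
qed

section \<open>Comparison with fair labels\<close>

text \<open>
  The labels at the positions in \<open>J\<close> are overwritten by the indicator of \<open>S\<close>, so that summing over
  the subsets \<open>S\<close> of \<open>J\<close> is an expectation over independent fair coins.
\<close>
definition relabel :: "'i set \<Rightarrow> 'i set \<Rightarrow> ('i \<Rightarrow> 'x \<times> bool) \<Rightarrow> 'i \<Rightarrow> 'x \<times> bool" where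
  "relabel J S w = (\<lambda>i. if i \<in> J then (fst (w i), i \<in> S) else w i)"

lemma product_prob_space_populations:
  assumes "\<And>i. population (M i)"
  shows "product_prob_space M"
  using population_D(1)[OF assms] 
  by (intro product_prob_space.intro product_sigma_finite.intro product_prob_space_axioms.intro)
     (auto intro: prob_space_imp_sigma_finite)

lemma measurable_relabel:
  fixes M :: "'i \<Rightarrow> ((real^'d) \<times> bool) measure"
  assumes "\<And>i. population (M i)" "J \<subseteq> I"
  shows "relabel J S \<in> PiM I M \<rightarrow>\<^sub>M PiM I M"
proof (rule measurable_PiM_single')
  fix i assume i: "i \<in> I"
  have c: "(\<lambda>w. w i) \<in> PiM I M \<rightarrow>\<^sub>M M i" using i by simp
  have "(\<lambda>z. (fst z, b)) \<in> M i \<rightarrow>\<^sub>M M i" for b :: bool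
    using population_D(7)[OF assms(1)[of i]]
    unfolding measurable_cong_sets[OF refl population_D(2)[OF assms(1)[of i]]] by auto
  from measurable_compose[OF c this] c show "(\<lambda>w. relabel J S w i) \<in> PiM I M \<rightarrow>\<^sub>M M i"
    unfolding relabel_def by (cases "i \<in> J") auto
next
  show "relabel J S \<in> space (PiM I M) \<rightarrow> (\<Pi>\<^sub>E i\<in>I. space (M i))"
    using assms(2) by (auto simp: relabel_def space_PiM PiE_def extensional_def population_D(3)[OF assms(1)])
qed

lemma nn_integral_PiM_le_fair_label:
  fixes M :: "'i \<Rightarrow> ((real^'d) \<times> bool) measure"
  assumes "finite I" and pop: "\<And>i. population (M i)" and reg: "\<And>i. regression_function (M i) (\<eta> i)"
    and F: "F \<in> borel_measurable (PiM I M)" and a: "a \<in> I"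
    and up: "\<And>w. \<eta> a (fst (w a)) > 1/2 \<Longrightarrow> F (w(a := (fst (w a), True))) \<le> F (w(a := (fst (w a), False)))"
    and down: "\<And>w. \<eta> a (fst (w a)) < 1/2 \<Longrightarrow> F (w(a := (fst (w a), False))) \<le> F (w(a := (fst (w a), True)))"
  shows "(\<integral>\<^sup>+ w. F w \<partial>PiM I M) \<le>
    (\<integral>\<^sup>+ w. ennreal (1/2) * (F (relabel {a} {a} w) + F (relabel {a} {} w)) \<partial>PiM I M)"
proof -
  interpret product_prob_space M by (rule product_prob_space_populations[OF pop])
  define K where "K = I - {a}"
  have K: "finite K" "a \<notin> K" "insert a K = I" using assms(1) a by (auto simp: K_def)
  have r: "relabel {a} S w = w(a := (fst (w a), a \<in> S))" for S and w :: "'i \<Rightarrow> (real^'d) \<times> bool"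
    by (auto simp: relabel_def)
  have F': "F \<in> borel_measurable (PiM (insert a K) M)" using F K by simp
  have F'': "(\<lambda>w. ennreal (1/2) * (F (relabel {a} {a} w) + F (relabel {a} {} w))) \<in> borel_measurable (PiM (insert a K) M)"
  proof -
    have "(\<lambda>w. F (relabel {a} S w)) \<in> borel_measurable (PiM I M)" for S
      by (rule measurable_compose[OF measurable_relabel[OF pop] F]) (use a in simp)
    note [measurable] = this
    show ?thesis unfolding K(3) by measurable
  qed
  have "(\<integral>\<^sup>+ w. F w \<partial>PiM I M) = (\<integral>\<^sup>+ w. (\<integral>\<^sup>+ z. F (w(a := z)) \<partial>M a) \<partial>PiM K M)"
    using product_nn_integral_insert[OF K(1,2) F'] K(3) by simp
  also have "\<dots> \<le> (\<integral>\<^sup>+ w. (\<integral>\<^sup>+ z. ennreal (1/2) * (F (w(a := (fst z, True))) + F (w(a := (fst z, False)))) \<partial>M a) \<partial>PiM K M)"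
  proof (rule nn_integral_mono)
    fix w assume w: "w \<in> space (PiM K M)"
    show "(\<integral>\<^sup>+ z. F (w(a := z)) \<partial>M a) \<le> (\<integral>\<^sup>+ z. ennreal (1/2) * (F (w(a := (fst z, True))) + F (w(a := (fst z, False)))) \<partial>M a)"
    proof (rule nn_integral_le_fair_label[OF pop reg])
      show "(\<lambda>z. F (w(a := z))) \<in> borel_measurable (M a)"
        using measurable_comp[OF measurable_component_update F', OF w K(2)] unfolding comp_def .
      show "F (w(a := (x, True))) \<le> F (w(a := (x, False)))" if "\<eta> a x > 1/2" for x
        using up[of "w(a := (x, True))"] that by simp
      show "F (w(a := (x, False))) \<le> F (w(a := (x, True)))" if "\<eta> a x < 1/2" for x
        using down[of "w(a := (x, True))"] that by simp
    qed
  qed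
  also have "\<dots> = (\<integral>\<^sup>+ w. ennreal (1/2) * (F (relabel {a} {a} w) + F (relabel {a} {} w)) \<partial>PiM I M)"
    using product_nn_integral_insert[OF K(1,2) F''] K(3) by (simp add: r)
  finally show ?thesis .
qed

text \<open>
  The comparison with fair coins, one coordinate after the other. After it, the covariates are fixed
  inside the integral, and the average over \<open>S\<close> is a finite coin-tossing problem.
\<close>
lemma nn_integral_PiM_le_fair_labels:
  fixes M :: "'i \<Rightarrow> ((real^'d) \<times> bool) measure"
  assumes "finite I" and pop: "\<And>i. population (M i)" and reg: "\<And>i. regression_function (M i) (\<eta> i)"
    and F: "F \<in> borel_measurable (PiM I M)"
    and up: "\<And>a w. a \<in> I \<Longrightarrow> \<eta> a (fst (w a)) > 1/2 \<Longrightarrow> F (w(a := (fst (w a), True))) \<le> F (w(a := (fst (w a), False)))"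
    and down: "\<And>a w. a \<in> I \<Longrightarrow> \<eta> a (fst (w a)) < 1/2 \<Longrightarrow> F (w(a := (fst (w a), False))) \<le> F (w(a := (fst (w a), True)))"
  shows "(\<integral>\<^sup>+ w. F w \<partial>PiM I M) \<le> (\<integral>\<^sup>+ w. ennreal (1 / 2 ^ card I) * (\<Sum>S\<in>Pow I. F (relabel I S w)) \<partial>PiM I M)"
proof -
  have Fr: "(\<lambda>w. F (relabel J S w)) \<in> borel_measurable (PiM I M)" if "J \<subseteq> I" for J S
    by (rule measurable_compose[OF measurable_relabel[OF pop that] F])
  have "(\<integral>\<^sup>+ w. F w \<partial>PiM I M) \<le> ennreal (1 / 2 ^ card J) * (\<Sum>S\<in>Pow J. \<integral>\<^sup>+ w. F (relabel J S w) \<partial>PiM I M)"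
    if "J \<subseteq> I" for J
    using finite_subset[OF that assms(1)] that
  proof (induction J rule: finite_induct)
    case empty
    then show ?case by (simp add: relabel_def)
  next
    case (insert a J)
    have step: "(\<integral>\<^sup>+ w. F (relabel J S w) \<partial>PiM I M) \<le> ennreal (1/2) *
        ((\<integral>\<^sup>+ w. F (relabel (insert a J) (insert a S) w) \<partial>PiM I M) + (\<integral>\<^sup>+ w. F (relabel (insert a J) S w) \<partial>PiM I M))"
      if S: "S \<in> Pow J" for S
    proof -
      have u: "relabel J S (w(a := z)) = (relabel J S w)(a := z)" and f: "fst (relabel J S w a) = fst (w a)"
        for w :: "'i \<Rightarrow> (real^'d) \<times> bool" and z
        using insert(2) by (auto simp: relabel_def fun_eq_iff)
      have r: "relabel J S (relabel {a} {a} w) = relabel (insert a J) (insert a S) w"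
        "relabel J S (relabel {a} {} w) = relabel (insert a J) S w" for w :: "'i \<Rightarrow> (real^'d) \<times> bool"
        using insert(2) S by (auto simp: relabel_def fun_eq_iff)
      have "(\<integral>\<^sup>+ w. F (relabel J S w) \<partial>PiM I M) \<le>
        (\<integral>\<^sup>+ w. ennreal (1/2) * (F (relabel J S (relabel {a} {a} w)) + F (relabel J S (relabel {a} {} w))) \<partial>PiM I M)"
      proof (rule nn_integral_PiM_le_fair_label[OF assms(1) pop reg, where F = "\<lambda>w. F (relabel J S w)"])
        show "(\<lambda>w. F (relabel J S w)) \<in> borel_measurable (PiM I M)" using insert by (intro Fr) auto
        show "a \<in> I" using insert by auto
        fix w :: "'i \<Rightarrow> (real^'d) \<times> bool"
        show "F (relabel J S (w(a := (fst (w a), True)))) \<le> F (relabel J S (w(a := (fst (w a), False))))"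
          if "\<eta> a (fst (w a)) > 1/2"
          using up[of a "relabel J S w"] insert that unfolding u f by auto
        show "F (relabel J S (w(a := (fst (w a), False)))) \<le> F (relabel J S (w(a := (fst (w a), True))))"
          if "\<eta> a (fst (w a)) < 1/2"
          using down[of a "relabel J S w"] insert that unfolding u f by auto
      qed
      also have "\<dots> = ennreal (1/2) * ((\<integral>\<^sup>+ w. F (relabel (insert a J) (insert a S) w) \<partial>PiM I M) + (\<integral>\<^sup>+ w. F (relabel (insert a J) S w) \<partial>PiM I M))"
        unfolding r using Fr[OF insert(4)] by (simp add: nn_integral_cmult nn_integral_add)
      finally show ?thesis .
    qed
    have split: "(\<Sum>S\<in>Pow (insert a J). f S) = (\<Sum>S\<in>Pow J. f (insert a S) + f S)" for f :: "'i set \<Rightarrow> ennreal"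
    proof -
      have "inj_on (insert a) (Pow J)"
        using insert(2) by (intro inj_onI) (metis Diff_insert_absorb PowD subsetD)
      moreover have "Pow J \<inter> insert a ` Pow J = {}" using insert by auto
      ultimately show ?thesis using insert(1) unfolding Pow_insert
        by (simp add: sum.union_disjoint sum.reindex sum.distrib add.commute)
    qed
    have "(\<integral>\<^sup>+ w. F w \<partial>PiM I M) \<le> ennreal (1 / 2 ^ card J) * (\<Sum>S\<in>Pow J. \<integral>\<^sup>+ w. F (relabel J S w) \<partial>PiM I M)"
      using insert by auto
    also have "\<dots> \<le> ennreal (1 / 2 ^ card J) * (\<Sum>S\<in>Pow J. ennreal (1/2) *
        ((\<integral>\<^sup>+ w. F (relabel (insert a J) (insert a S) w) \<partial>PiM I M) + (\<integral>\<^sup>+ w. F (relabel (insert a J) S w) \<partial>PiM I M)))"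
      using step by (intro mult_left_mono sum_mono) auto
    also have "\<dots> = (ennreal (1 / 2 ^ card J) * ennreal (1/2)) * (\<Sum>S\<in>Pow (insert a J). \<integral>\<^sup>+ w. F (relabel (insert a J) S w) \<partial>PiM I M)"
      unfolding split by (simp add: sum_distrib_left mult.assoc)
    also have "ennreal (1 / 2 ^ card J) * ennreal (1/2) = ennreal (1 / 2 ^ card (insert a J))"
      using insert(1,2) by (subst ennreal_mult[symmetric]) (auto simp: field_simps)
    finally show ?case .
  qed
  from this[of I] show ?thesis using Fr[of I]
    by (simp add: nn_integral_cmult nn_integral_sum)
qed

section \<open>The two bad events\<close>

lemma measurable_directed_signal:
  fixes I :: "('g::finite \<times> 'j) set"
  assumes "finite I"
    and P: "\<And>a. a \<in> I \<Longrightarrow> Measurable.pred N (\<lambda>w. P w a)"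
    and y: "\<And>a. a \<in> I \<Longrightarrow> Measurable.pred N (\<lambda>w. y w a)"
  shows "(\<lambda>w. directed_signal s {a \<in> I. P w a} (y w)) \<in> borel_measurable N"
proof -
  let ?I = "\<lambda>g. {a \<in> I. fst a = g}"
  have "directed_signal s {a \<in> I. P w a} (y w) = (\<Sum>g\<in>UNIV.
      (max 0 (s * (\<Sum>a\<in>?I g. if P w a then if y w a then 1/2 else - 1/2 else 0)))\<^sup>2
      / (\<Sum>a\<in>?I g. if P w a then 1 else 0))" for w
    unfolding directed_signal_def
  proof (intro sum.cong refl)
    fix g
    have s: "{a. a \<in> {a \<in> I. P w a} \<and> fst a = g} = ?I g \<inter> {a. P w a}" by auto
    have "(\<Sum>a | a \<in> {a \<in> I. P w a} \<and> fst a = g. of_bool (y w a) - 1/2) = (\<Sum>a\<in>?I g. if P w a then if y w a then 1/2 else - 1/2 else 0 :: real)"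
      unfolding s using assms(1) by (subst sum.inter_restrict) (auto intro!: sum.cong)
    moreover have "real (card {a \<in> {a \<in> I. P w a}. fst a = g}) = (\<Sum>a\<in>?I g. if P w a then 1 else 0)"
      unfolding s using assms(1) by (subst sum.inter_filter[symmetric]) (auto simp: Int_def)
    ultimately show "(max 0 (s * (\<Sum>a | a \<in> {a \<in> I. P w a} \<and> fst a = g. of_bool (y w a) - 1/2)))\<^sup>2 / real (card {a \<in> {a \<in> I. P w a}. fst a = g})
      = (max 0 (s * (\<Sum>a\<in>?I g. if P w a then if y w a then 1/2 else - 1/2 else 0)))\<^sup>2 / (\<Sum>a\<in>?I g. if P w a then 1 else 0)"
      by simp
  qed
  moreover have "(\<lambda>w. \<Sum>g\<in>UNIV.
      (max 0 (s * (\<Sum>a\<in>?I g. if P w a then if y w a then 1/2 else - 1/2 else 0)))\<^sup>2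
      / (\<Sum>a\<in>?I g. if P w a then 1 else 0)) \<in> borel_measurable N"
  proof (intro borel_measurable_sum borel_measurable_divide borel_measurable_power borel_measurable_max borel_measurable_times borel_measurable_const)
    fix g a assume "a \<in> ?I g"
    then have [measurable]: "Measurable.pred N (\<lambda>w. P w a)" "Measurable.pred N (\<lambda>w. y w a)" using P y by auto
    show "(\<lambda>w. if P w a then if y w a then 1/2 else - 1/2 else 0 :: real) \<in> borel_measurable N" by measurable
    show "(\<lambda>w. if P w a then 1 else 0 :: real) \<in> borel_measurable N" by measurable
  qed
  ultimately show ?thesis by simp
qed

text \<open>
  Some neighbourhood of \<open>x\<close> of radius below \<open>\<rho>\<close> votes against the direction \<open>s\<close> with strength above
  \<open>L\<close>. The neighbourhoods are described by their outermost observation \<open>b\<close> instead of a ranking, which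
  makes the event meaningful in the presence of ties and independent of how they are broken.
\<close>
definition misleading ::
  "('g::finite \<times> 'j) set \<Rightarrow> real \<Rightarrow> real \<Rightarrow> real \<Rightarrow> 'x::metric_space \<Rightarrow> ('g \<times> 'j \<Rightarrow> 'x \<times> bool) \<Rightarrow> bool" where
  "misleading I s L \<rho> x w \<longleftrightarrow> (\<exists>b\<in>I. dist x (fst (w b)) < \<rho> \<and>
     directed_signal (- s) {a \<in> I. dist x (fst (w a)) \<le> dist x (fst (w b))} (\<lambda>a. snd (w a)) > L)"

text \<open>
  Moving labels within the ball away from the direction \<open>s\<close> preserves the event, and labels
  outside the ball do not enter it at all.
\<close>
lemma misleading_mono:
  assumes "finite I" "misleading I s L \<rho> x w"
    and "\<And>a. a \<in> I \<Longrightarrow> fst (w' a) = fst (w a)"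
    and "\<And>a. a \<in> I \<Longrightarrow> dist x (fst (w a)) < \<rho> \<Longrightarrow> s * of_bool (snd (w' a)) \<le> s * of_bool (snd (w a))"
  shows "misleading I s L \<rho> x w'"
proof -
  obtain b where b: "b \<in> I" "dist x (fst (w b)) < \<rho>"
    "directed_signal (- s) {a \<in> I. dist x (fst (w a)) \<le> dist x (fst (w b))} (\<lambda>a. snd (w a)) > L"
    using assms(2) unfolding misleading_def by blast
  have "directed_signal (- s) {a \<in> I. dist x (fst (w a)) \<le> dist x (fst (w b))} (\<lambda>a. snd (w a))
    \<le> directed_signal (- s) {a \<in> I. dist x (fst (w a)) \<le> dist x (fst (w b))} (\<lambda>a. snd (w' a))"
    using assms(1,4) b(2) by (intro directed_signal_antimono) force+
  with b(3) have "L < directed_signal (- s) {a \<in> I. dist x (fst (w a)) \<le> dist x (fst (w b))} (\<lambda>a. snd (w' a))"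
    by linarith
  also have "{a \<in> I. dist x (fst (w a)) \<le> dist x (fst (w b))} = {a \<in> I. dist x (fst (w' a)) \<le> dist x (fst (w' b))}"
    using assms(3) b(1) by auto
  finally show ?thesis using b(1,2) assms(3)[OF b(1)] unfolding misleading_def by (intro bexI[of _ b] conjI) simp_all
qed

lemma measurable_observation:
  fixes M :: "'i \<Rightarrow> ((real^'d) \<times> bool) measure"
  assumes "\<And>i. population (M i)" "a \<in> I"
  shows "(\<lambda>w. fst (w a)) \<in> PiM I M \<rightarrow>\<^sub>M borel" "Measurable.pred (PiM I M) (\<lambda>w. snd (w a))"
proof -
  have c: "(\<lambda>w. w a) \<in> PiM I M \<rightarrow>\<^sub>M M a" using assms(2) by simp
  show "(\<lambda>w. fst (w a)) \<in> PiM I M \<rightarrow>\<^sub>M borel"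
    by (rule measurable_compose[OF c population_D(7)[OF assms(1)]])
  show "Measurable.pred (PiM I M) (\<lambda>w. snd (w a))"
    by (rule measurable_compose[OF c population_D(8)[OF assms(1)]])
qed

lemma measurable_misleading:
  fixes M :: "('g::finite \<times> 'j) \<Rightarrow> ((real^'d) \<times> bool) measure"
  assumes "\<And>i. population (M i)" "finite I"
  shows "Measurable.pred (PiM I M) (misleading I s L \<rho> x)"
  unfolding misleading_def
proof (intro pred_intros_finite(4) assms(2))
  fix b assume b: "b \<in> I"
  note obs = measurable_observation[of M, OF assms(1)]
  have "(\<lambda>w. directed_signal (- s) {a \<in> I. dist x (fst (w a)) \<le> dist x (fst (w b))} (\<lambda>a. snd (w a))) \<in> borel_measurable (PiM I M)"
  proof (rule measurable_directed_signal[OF assms(2), where y = "\<lambda>w a. snd (w a)"])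
    fix a assume a: "a \<in> I"
    show "Measurable.pred (PiM I M) (\<lambda>w. dist x (fst (w a)) \<le> dist x (fst (w b)))"
      unfolding Measurable.pred_def by (intro borel_measurable_le borel_measurable_dist borel_measurable_const obs(1)[OF a] obs(1)[OF b])
    show "Measurable.pred (PiM I M) (\<lambda>w. snd (w a))" by (rule obs(2)[OF a])
  qed
  note [measurable] = this obs(1)[OF b]
  show "Measurable.pred (PiM I M) (\<lambda>w. dist x (fst (w b)) < \<rho> \<and>
     directed_signal (- s) {a \<in> I. dist x (fst (w a)) \<le> dist x (fst (w b))} (\<lambda>a. snd (w a)) > L)"
    by measurable
qed

text \<open>
  The regression functions lie on the side \<open>s\<close> throughout the ball, so by \<open>misleading_mono\<close> the labels
  may be replaced by fair coins. For fixed covariates there are at most \<open>card I\<close> neighbourhoods, each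
  subject to \<open>fair_labels_tail\<close>.
\<close>
lemma prob_misleading:
  fixes D :: "'g::finite \<Rightarrow> ((real^'d) \<times> bool) measure" and I :: "('g \<times> 'j) set"
  assumes fin: "finite I" and pop: "\<And>g. population (D g)" and reg: "\<And>g. regression_function (D g) (\<eta> g)"
    and s: "\<bar>s\<bar> = 1" and same: "\<And>g z. dist x z < \<rho> \<Longrightarrow> s * (\<eta> g z - 1/2) \<ge> 0"
  shows "emeasure (PiM I (\<lambda>a. D (fst a))) {w \<in> space (PiM I (\<lambda>a. D (fst a))). misleading I s L \<rho> x w}
    \<le> ennreal (real (card I) * exp (real CARD('g) / 2 - L))"
proof -
  define M where "M = (\<lambda>a::'g \<times> 'j. D (fst a))"
  have pM: "population (M a)" for a unfolding M_def by (rule pop)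
  have rM: "regression_function (M a) (\<eta> (fst a))" for a unfolding M_def by (rule reg)
  interpret product_prob_space M by (rule product_prob_space_populations[OF pM])
  define F :: "('g \<times> 'j \<Rightarrow> (real^'d) \<times> bool) \<Rightarrow> ennreal" where "F = (\<lambda>w. of_bool (misleading I s L \<rho> x w))"
  have [measurable]: "Measurable.pred (PiM I M) (misleading I s L \<rho> x)"
    by (rule measurable_misleading[OF pM fin])
  have Fm: "F \<in> borel_measurable (PiM I M)" unfolding F_def by measurable
  have Fmono: "F (w(a := (fst (w a), c))) \<le> F (w(a := (fst (w a), c')))"
    if "a \<in> I" "dist x (fst (w a)) < \<rho> \<Longrightarrow> s * of_bool c' \<le> s * of_bool c" for w a c c'
  proof (cases "misleading I s L \<rho> x (w(a := (fst (w a), c)))")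
    case True
    have "misleading I s L \<rho> x (w(a := (fst (w a), c')))"
      by (rule misleading_mono[OF fin True]) (use that in \<open>auto split: if_splits\<close>)
    then show ?thesis by (simp add: F_def)
  qed (simp add: F_def)
  have one: "s = 1 \<or> s = - 1" using s by auto
  have bound: "ennreal (1 / 2 ^ card I) * (\<Sum>S\<in>Pow I. F (relabel I S w)) \<le> ennreal (real (card I) * exp (real CARD('g) / 2 - L))"
    for w
  proof -
    define A where "A = (\<lambda>b. {a \<in> I. dist x (fst (w a)) \<le> dist x (fst (w b))})"
    have r: "misleading I s L \<rho> x (relabel I S w) \<Longrightarrow> \<exists>b\<in>I. directed_signal (- s) (A b) (\<lambda>a. a \<in> S) > L" for S
    proof -
      assume "misleading I s L \<rho> x (relabel I S w)"
      then obtain b where b: "b \<in> I" "directed_signal (- s) {a \<in> I. dist x (fst (relabel I S w a)) \<le> dist x (fst (relabel I S w b))} (\<lambda>a. snd (relabel I S w a)) > L"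
        unfolding misleading_def by blast
      have "{a \<in> I. dist x (fst (relabel I S w a)) \<le> dist x (fst (relabel I S w b))} = A b"
        using b(1) unfolding A_def relabel_def by auto
      moreover have "directed_signal (- s) (A b) (\<lambda>a. snd (relabel I S w a)) \<le> directed_signal (- s) (A b) (\<lambda>a. a \<in> S)"
        using fin by (intro directed_signal_antimono) (auto simp: A_def relabel_def)
      ultimately show ?thesis using b by (intro bexI[of _ b]) auto
    qed
    have "(\<Sum>S\<in>Pow I. F (relabel I S w)) \<le> (\<Sum>S\<in>Pow I. ennreal (\<Sum>b\<in>I. of_bool (directed_signal (- s) (A b) (\<lambda>a. a \<in> S) > L)))"
    proof (rule sum_mono)
      fix S
      show "F (relabel I S w) \<le> ennreal (\<Sum>b\<in>I. of_bool (directed_signal (- s) (A b) (\<lambda>a. a \<in> S) > L))"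
      proof (cases "misleading I s L \<rho> x (relabel I S w)")
        case True
        from r[OF this] obtain b where "b \<in> I" "directed_signal (- s) (A b) (\<lambda>a. a \<in> S) > L" by blast
        then have "1 \<le> (\<Sum>b\<in>I. of_bool (directed_signal (- s) (A b) (\<lambda>a. a \<in> S) > L) :: real)"
          using member_le_sum[of b I "\<lambda>b. of_bool (directed_signal (- s) (A b) (\<lambda>a. a \<in> S) > L) :: real"] fin by auto
        then show ?thesis using True unfolding F_def by simp
      qed (simp add: F_def)
    qed
    also have "\<dots> = ennreal (\<Sum>b\<in>I. \<Sum>S\<in>Pow I. of_bool (directed_signal (- s) (A b) (\<lambda>a. a \<in> S) > L))"
      unfolding sum.swap[of _ "Pow I" I] by (rule sum_ennreal) (auto intro: sum_nonneg)
    also have "\<dots> \<le> ennreal (\<Sum>b\<in>I. 2 ^ card I * exp (real CARD('g) / 2 - L))"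
    proof (intro ennreal_leI sum_mono)
      fix b assume "b \<in> I"
      have "(\<Sum>S\<in>Pow I. of_bool (directed_signal (- s) (A b) (\<lambda>a. a \<in> S) > L)) = real (card {S \<in> Pow I. directed_signal (- s) (A b) (\<lambda>a. a \<in> S) > L})"
        using fin by (subst sum_of_bool_eq) (auto intro: arg_cong[where f = card])
      also have "\<dots> \<le> 2 ^ card I * exp (real CARD('g) / 2 - L)"
        using s by (intro fair_labels_tail[OF fin]) (auto simp: A_def)
      finally show "(\<Sum>S\<in>Pow I. of_bool (directed_signal (- s) (A b) (\<lambda>a. a \<in> S) > L)) \<le> 2 ^ card I * exp (real CARD('g) / 2 - L)" .
    qed
    finally have "ennreal (1 / 2 ^ card I) * (\<Sum>S\<in>Pow I. F (relabel I S w))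
      \<le> ennreal (1 / 2 ^ card I) * ennreal (\<Sum>b\<in>I. 2 ^ card I * exp (real CARD('g) / 2 - L))"
      by (rule mult_left_mono) simp
    also have "\<dots> = ennreal (real (card I) * exp (real CARD('g) / 2 - L))"
      by (subst ennreal_mult[symmetric]) auto
    finally show ?thesis .
  qed
  have "emeasure (PiM I M) {w \<in> space (PiM I M). misleading I s L \<rho> x w} = (\<integral>\<^sup>+ w. F w \<partial>PiM I M)"
  proof -
    have "emeasure (PiM I M) {w \<in> space (PiM I M). misleading I s L \<rho> x w} = (\<integral>\<^sup>+ w. indicator {w \<in> space (PiM I M). misleading I s L \<rho> x w} w \<partial>PiM I M)"
      by (subst nn_integral_indicator) auto
    also have "\<dots> = (\<integral>\<^sup>+ w. F w \<partial>PiM I M)"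
      by (intro nn_integral_cong) (auto simp: F_def)
    finally show ?thesis .
  qed
  also have "\<dots> \<le> (\<integral>\<^sup>+ w. ennreal (1 / 2 ^ card I) * (\<Sum>S\<in>Pow I. F (relabel I S w)) \<partial>PiM I M)"
  proof (rule nn_integral_PiM_le_fair_labels[OF fin pM rM Fm])
    show "F (w(a := (fst (w a), True))) \<le> F (w(a := (fst (w a), False)))"
      if "a \<in> I" "\<eta> (fst a) (fst (w a)) > 1/2" for a w
      by (rule Fmono) (use that one same[of "fst (w a)" "fst a"] in auto)
    show "F (w(a := (fst (w a), False))) \<le> F (w(a := (fst (w a), True)))"
      if "a \<in> I" "\<eta> (fst a) (fst (w a)) < 1/2" for a w
      by (rule Fmono) (use that one same[of "fst (w a)" "fst a"] in auto)
  qed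
  also have "\<dots> \<le> (\<integral>\<^sup>+ w. ennreal (real (card I) * exp (real CARD('g) / 2 - L)) \<partial>PiM I M)"
    by (intro nn_integral_mono bound)
  also have "\<dots> = ennreal (real (card I) * exp (real CARD('g) / 2 - L))"
    using prob_space.emeasure_space_1[OF prob_space_PiM[OF population_D(1)[OF pM]], of I] by simp
  finally show ?thesis unfolding M_def .
qed

text \<open>
  Conditionally on one covariate, another one falls on the sphere through it with probability zero.
\<close>
lemma AE_distinct_distances:
  fixes M :: "'i \<Rightarrow> ((real^'d) \<times> bool) measure"
  assumes fin: "finite I" and pop: "\<And>i. population (M i)"
    and sph: "\<And>i r. emeasure (covariate_law (M i)) (sphere x r) = 0"
  shows "AE w in PiM I M. \<forall>a\<in>I. \<forall>b\<in>I. a \<noteq> b \<longrightarrow> dist x (fst (w a)) \<noteq> dist x (fst (w b))"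
proof -
  interpret product_prob_space M by (rule product_prob_space_populations[OF pop])
  have pair: "AE w in PiM I M. dist x (fst (w a)) \<noteq> dist x (fst (w b))" if a: "a \<in> I" and b: "b \<in> I" and ab: "a \<noteq> b" for a b
  proof -
    define K where "K = I - {a}"
    have K: "finite K" "a \<notin> K" "insert a K = I" using fin a by (auto simp: K_def)
    note [measurable] = measurable_observation(1)[of M, OF pop a] measurable_observation(1)[of M, OF pop b]
    define N where "N = {w \<in> space (PiM I M). dist x (fst (w a)) = dist x (fst (w b))}"
    have N [measurable]: "N \<in> sets (PiM I M)" unfolding N_def by measurable
    have "emeasure (PiM I M) N = (\<integral>\<^sup>+ w. (\<integral>\<^sup>+ z. indicator N (w(a := z)) \<partial>M a) \<partial>PiM K M)"
      using product_nn_integral_insert[OF K(1,2), of "indicator N"] N K(3) by simp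
    also have "\<dots> = (\<integral>\<^sup>+ w. 0 \<partial>PiM K M)"
    proof (rule nn_integral_cong)
      fix w
      have "(\<integral>\<^sup>+ z. indicator N (w(a := z)) \<partial>M a) \<le> (\<integral>\<^sup>+ z. indicator (sphere x (dist x (fst (w b)))) (fst z) \<partial>M a)"
        using ab by (intro nn_integral_mono) (auto simp: N_def indicator_def)
      also have "\<dots> = (\<integral>\<^sup>+ z. indicator (sphere x (dist x (fst (w b)))) z \<partial>covariate_law (M a))"
        by (rule nn_integral_covariate_law[OF pop]) (auto intro!: borel_measurable_indicator borel_closed)
      also have "\<dots> = 0" using sph[of a] population_D(5)[OF pop, of a] by (simp add: borel_closed)
      finally show "(\<integral>\<^sup>+ z. indicator N (w(a := z)) \<partial>M a) = 0" by simp
    qed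
    finally have "N \<in> null_sets (PiM I M)" using N by (auto simp: null_sets_def)
    then show ?thesis by (rule AE_I') (auto simp: N_def)
  qed
  show ?thesis
  proof (intro AE_finite_allI[OF fin])
    fix a b assume "a \<in> I" "b \<in> I"
    then show "AE w in PiM I M. a \<noteq> b \<longrightarrow> dist x (fst (w a)) \<noteq> dist x (fst (w b))"
      using pair[of a b] by (cases "a = b") auto
  qed
qed

text \<open>
  The moment bound for one label in the ball. The bias contributes a term of order \<open>- 4 h\<^sup>2\<close>, which
  outweighs both the variance term \<open>h\<^sup>2/2\<close> of \<open>cosh h\<close> and the normalising factor \<open>exp (h\<^sup>2)\<close>.
\<close>
lemma biased_label_mgf:
  fixes q h s :: real
  assumes h: "0 \<le> h" "h \<le> 1/4" and s: "\<bar>s\<bar> = 1" and q: "s * (q - 1/2) \<ge> 2 * h"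
  shows "q * exp (h\<^sup>2 - h * s) + (1 - q) * exp (h\<^sup>2 + h * s) \<le> 1 - h\<^sup>2 / 2"
proof -
  define r where "r = s * (q - 1/2)"
  have s': "s = 1 \<or> s = - 1" using s by auto
  have "q * exp (h\<^sup>2 - h * s) + (1 - q) * exp (h\<^sup>2 + h * s) = exp (h\<^sup>2) * (cosh h - r * (exp h - exp (- h)))"
    using s' by (auto simp: r_def cosh_def exp_diff exp_add exp_minus field_simps)
  also have "\<dots> \<le> exp (h\<^sup>2) * (exp (h\<^sup>2 / 2) - 7/2 * h\<^sup>2)"
  proof (intro mult_left_mono diff_mono cosh_le_exp_half_square)
    have "exp (- h) = 1 / exp h" by (simp add: exp_minus divide_inverse)
    also have "\<dots> \<le> 1 / (1 + h)" using h exp_ge_add_one_self[of h] by (intro divide_left_mono) auto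
    also have "\<dots> \<le> 1 - h + h\<^sup>2"
    proof -
      have "(1 - h + h\<^sup>2) * (1 + h) = 1 + h ^ 3" by (simp add: algebra_simps power2_eq_square power3_eq_cube)
      moreover have "h ^ 3 \<ge> 0" using h by simp
      ultimately show ?thesis using h by (simp add: divide_le_eq)
    qed
    finally have e: "exp (- h) \<le> 1 - h + h\<^sup>2" .
    have hh: "h\<^sup>2 \<le> h / 4" using mult_left_mono[OF h(2) h(1)] by (simp add: power2_eq_square)
    have e1: "1 + h \<le> exp h" by (rule exp_ge_add_one_self)
    have e7: "7/4 * h \<le> exp h - exp (- h)" using e hh e1 by linarith
    have "7/2 * h\<^sup>2 = 2 * h * (7/4 * h)" by (simp add: power2_eq_square)
    also have "\<dots> \<le> 2 * h * (exp h - exp (- h))"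
      using h e7 by (intro mult_left_mono) auto
    also have "\<dots> \<le> r * (exp h - exp (- h))"
      using q h unfolding r_def by (intro mult_right_mono) auto
    finally show "7/2 * h\<^sup>2 \<le> r * (exp h - exp (- h))" .
  qed auto
  also have "\<dots> = exp (3/2 * h\<^sup>2) - 7/2 * (h\<^sup>2 * exp (h\<^sup>2))"
    by (simp add: right_diff_distrib flip: exp_add)
  also have "\<dots> \<le> (1 + 2 * (3/2 * h\<^sup>2)) - 7/2 * (h\<^sup>2 * 1)"
  proof (intro diff_mono mult_left_mono)
    have "h\<^sup>2 \<le> (1/4)\<^sup>2" using h by (intro power_mono) auto
    then show "exp (3/2 * h\<^sup>2) \<le> 1 + 2 * (3/2 * h\<^sup>2)"
      by (intro real_exp_bound_lemma) (auto simp: power2_eq_square)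
  qed auto
  finally show ?thesis by simp
qed

text \<open>
  With slope \<open>h = \<tau>/2\<close> in \<open>directed_signal_ge_linear\<close>, the signal of population \<open>g\<close> dominates a sum of
  independent terms, and by \<open>biased_label_mgf\<close> each of them has exponential moment at most
  \<open>1 - p h\<^sup>2/2\<close>, as it vanishes for covariates outside the ball.
\<close>
lemma prob_weak_signal:
  fixes D :: "'g::finite \<Rightarrow> ((real^'d) \<times> bool) measure" and I :: "('g \<times> 'j) set"
  assumes fin: "finite I" and pop: "\<And>g. population (D g)" and reg: "regression_function (D g) \<eta>"
    and s: "\<bar>s\<bar> = 1" and \<tau>: "0 \<le> \<tau>" "\<tau> \<le> 1/2"
    and p: "0 \<le> p" "p \<le> measure (covariate_law (D g)) (ball x \<rho>)"
    and gain: "AE z in covariate_law (D g). dist x z < \<rho> \<longrightarrow> s * (\<eta> z - 1/2) \<ge> \<tau>"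
  shows "emeasure (PiM I (\<lambda>a. D (fst a))) {w \<in> space (PiM I (\<lambda>a. D (fst a))).
      directed_signal s {a \<in> I. dist x (fst (w a)) < \<rho>} (\<lambda>a. snd (w a)) \<le> L}
    \<le> ennreal (exp (L - real (card {a \<in> I. fst a = g}) * p * \<tau>\<^sup>2 / 8))"
proof -
  define M where "M = (\<lambda>a::'g \<times> 'j. D (fst a))"
  have pM: "population (M a)" for a unfolding M_def by (rule pop)
  interpret product_prob_space M by (rule product_prob_space_populations[OF pM])
  define h where "h = \<tau> / 2"
  have h: "0 \<le> h" "h \<le> 1/4" using \<tau> by (auto simp: h_def)
  define H where "H = covariate_law (D g)"
  interpret H: prob_space H unfolding H_def by (rule population_D[OF pop])
  have sH [measurable_cong]: "sets H = sets borel" unfolding H_def by (rule population_D[OF pop])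
  define v where "v = (\<lambda>z :: (real^'d) \<times> bool. if dist x (fst z) < \<rho> then 2 * h * (s * (of_bool (snd z) - 1/2)) - h\<^sup>2 else 0)"
  have obs: "fst \<in> D g \<rightarrow>\<^sub>M borel" "snd \<in> D g \<rightarrow>\<^sub>M count_space UNIV" for g
    using population_D(7,8)[OF pop] by auto
  have vm: "v \<in> borel_measurable (D g)" for g
  proof -
    note [measurable] = obs[of g]
    show ?thesis unfolding v_def by measurable
  qed
  note \<eta>01 = regression_functionD(2,3)[OF reg]
  have \<eta>m [measurable]: "\<eta> \<in> borel_measurable borel" by (rule regression_functionD(1)[OF reg])
  have ind: "integrable H (indicator (ball x \<rho>) :: _ \<Rightarrow> real)"
    by (rule integrable_real_indicator) (auto simp: sH H.emeasure_eq_measure)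
  have single: "(\<integral>\<^sup>+ z. ennreal (exp (- v z)) \<partial>D g) \<le> ennreal (exp (- (p * \<tau>\<^sup>2 / 8)))"
  proof -
    have "(\<integral>\<^sup>+ z. ennreal (exp (- v z)) \<partial>D g) = (\<integral>\<^sup>+ z. ennreal (\<eta> z) * ennreal (exp (- v (z, True))) + ennreal (1 - \<eta> z) * ennreal (exp (- v (z, False))) \<partial>H)"
      unfolding H_def using vm[of g] by (intro nn_integral_population[OF pop reg]) auto
    also have "\<dots> \<le> (\<integral>\<^sup>+ z. ennreal (1 - h\<^sup>2 / 2 * indicator (ball x \<rho>) z) \<partial>H)"
    proof (rule nn_integral_mono_AE)
      show "AE z in H. ennreal (\<eta> z) * ennreal (exp (- v (z, True))) + ennreal (1 - \<eta> z) * ennreal (exp (- v (z, False)))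
        \<le> ennreal (1 - h\<^sup>2 / 2 * indicator (ball x \<rho>) z)"
        using gain unfolding H_def[symmetric]
      proof eventually_elim
        case (elim z)
        have "\<eta> z * exp (- v (z, True)) + (1 - \<eta> z) * exp (- v (z, False)) \<le> 1 - h\<^sup>2 / 2 * indicator (ball x \<rho>) z"
        proof (cases "dist x z < \<rho>")
          case True
          then have "2 * h \<le> s * (\<eta> z - 1/2)" using elim by (simp add: h_def)
          from biased_label_mgf[OF h s this] True show ?thesis
            by (simp add: v_def algebra_simps)
        qed (simp add: v_def)
        then show ?case using \<eta>01[of z]
          by (simp flip: ennreal_mult ennreal_plus add: ennreal_leI)
      qed
    qed
    also have "\<dots> = ennreal (\<integral> z. 1 - h\<^sup>2 / 2 * indicator (ball x \<rho>) z \<partial>H)"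
    proof (rule nn_integral_eq_integral)
      show "integrable H (\<lambda>z. 1 - h\<^sup>2 / 2 * indicator (ball x \<rho>) z)"
        using ind by (intro Bochner_Integration.integrable_diff integrable_mult_right) auto
      have "h\<^sup>2 \<le> (1/4)\<^sup>2" using h by (intro power_mono) auto
      then show "AE z in H. 0 \<le> 1 - h\<^sup>2 / 2 * indicator (ball x \<rho>) z"
        by (auto simp: indicator_def power2_eq_square)
    qed
    also have "(\<integral> z. 1 - h\<^sup>2 / 2 * indicator (ball x \<rho>) z \<partial>H) = 1 - h\<^sup>2 / 2 * measure H (ball x \<rho>)"
      using ind by (subst Bochner_Integration.integral_diff) (auto simp: sH H.prob_space)
    also have "ennreal \<dots> \<le> ennreal (exp (- (p * \<tau>\<^sup>2 / 8)))"
    proof (rule ennreal_leI)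
      have "1 - h\<^sup>2 / 2 * measure H (ball x \<rho>) \<le> 1 - h\<^sup>2 / 2 * p"
        using p unfolding H_def by (intro diff_left_mono mult_left_mono) auto
      also have "\<dots> = 1 + - (p * \<tau>\<^sup>2 / 8)" by (simp add: h_def power2_eq_square)
      also have "\<dots> \<le> exp (- (p * \<tau>\<^sup>2 / 8))" by (rule exp_ge_add_one_self)
      finally show "1 - h\<^sup>2 / 2 * measure H (ball x \<rho>) \<le> exp (- (p * \<tau>\<^sup>2 / 8))" .
    qed
    finally show ?thesis .
  qed
  define I' where "I' = {a \<in> I. fst a = g}"
  have finI': "finite I'" using fin by (simp add: I'_def)
  define B where "B = {w \<in> space (PiM I M). directed_signal s {a \<in> I. dist x (fst (w a)) < \<rho>} (\<lambda>a. snd (w a)) \<le> L}"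
  have B: "B \<in> sets (PiM I M)"
  proof -
    have "(\<lambda>w. directed_signal s {a \<in> I. dist x (fst (w a)) < \<rho>} (\<lambda>a. snd (w a))) \<in> borel_measurable (PiM I M)"
    proof (rule measurable_directed_signal[OF fin, where y = "\<lambda>w a. snd (w a)"])
      fix a assume a: "a \<in> I"
      note [measurable] = measurable_observation[of M, OF pM a]
      show "Measurable.pred (PiM I M) (\<lambda>w. dist x (fst (w a)) < \<rho>)" by measurable
      show "Measurable.pred (PiM I M) (\<lambda>w. snd (w a))" by measurable
    qed
    note [measurable] = this
    show ?thesis unfolding B_def by measurable
  qed
  define f where "f = (\<lambda>(a :: 'g \<times> 'j) z. if fst a = g then ennreal (exp (- v z)) else 1)"
  have "emeasure (PiM I M) B = (\<integral>\<^sup>+ w. indicator B w \<partial>PiM I M)" using B by simp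
  also have "\<dots> \<le> (\<integral>\<^sup>+ w. ennreal (exp L) * (\<Prod>a\<in>I. f a (w a)) \<partial>PiM I M)"
  proof (rule nn_integral_mono)
    fix w
    show "indicator B w \<le> ennreal (exp L) * (\<Prod>a\<in>I. f a (w a))"
    proof (cases "w \<in> B")
      case True
      have "(\<Sum>a\<in>I'. v (w a)) = (\<Sum>a | a \<in> {a \<in> I. dist x (fst (w a)) < \<rho>} \<and> fst a = g. 2 * h * (s * (of_bool (snd (w a)) - 1/2)) - h\<^sup>2)"
        unfolding v_def sum.inter_filter[OF finI', symmetric] by (intro sum.cong) (auto simp: I'_def)
      also have "\<dots> \<le> directed_signal s {a \<in> I. dist x (fst (w a)) < \<rho>} (\<lambda>a. snd (w a))"
        using fin h by (intro directed_signal_ge_linear[where y = "\<lambda>a. snd (w a)"]) auto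
      also have "\<dots> \<le> L" using True by (simp add: B_def)
      finally have V: "(\<Sum>a\<in>I'. v (w a)) \<le> L" .
      have "(\<Prod>a\<in>I. f a (w a)) = (\<Prod>a\<in>I'. ennreal (exp (- v (w a))))"
        unfolding f_def I'_def by (rule prod.inter_filter[OF fin, symmetric])
      also have "\<dots> = ennreal (exp (- (\<Sum>a\<in>I'. v (w a))))"
        using finI' by (simp add: prod_ennreal exp_sum sum_negf[symmetric])
      finally have "ennreal (exp L) * (\<Prod>a\<in>I. f a (w a)) = ennreal (exp (L - (\<Sum>a\<in>I'. v (w a))))"
        by (simp flip: ennreal_mult exp_add)
      then show ?thesis using V True by simp
    qed simp
  qed
  also have "\<dots> = ennreal (exp L) * (\<Prod>a\<in>I. \<integral>\<^sup>+ z. f a z \<partial>M a)"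
  proof -
    have fm: "f a \<in> borel_measurable (M a)" for a
      using vm unfolding f_def M_def by (cases "fst a = g") auto
    then have "(\<lambda>w. \<Prod>a\<in>I. f a (w a)) \<in> borel_measurable (PiM I M)"
      by (intro borel_measurable_prod_ennreal measurable_compose[OF measurable_component_singleton]) auto
    then show ?thesis using fm by (subst nn_integral_cmult) (auto simp: product_nn_integral_prod[OF fin])
  qed
  also have "\<dots> \<le> ennreal (exp L) * (\<Prod>a\<in>I. if fst a = g then ennreal (exp (- (p * \<tau>\<^sup>2 / 8))) else 1)"
  proof (intro mult_left_mono prod_mono_ennreal)
    fix a
    show "(\<integral>\<^sup>+ z. f a z \<partial>M a) \<le> (if fst a = g then ennreal (exp (- (p * \<tau>\<^sup>2 / 8))) else 1)"
      using single prob_space.emeasure_space_1[OF population_D(1)[OF pM[of a]]]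
      unfolding f_def by (auto simp: M_def)
  qed auto
  also have "\<dots> = ennreal (exp L) * ennreal (exp (- (p * \<tau>\<^sup>2 / 8))) ^ card I'"
    unfolding I'_def using fin by (simp add: prod.inter_filter[symmetric])
  also have "\<dots> = ennreal (exp (L - real (card I') * p * \<tau>\<^sup>2 / 8))"
    by (simp add: ennreal_power exp_of_nat_mult[symmetric] flip: ennreal_mult exp_add)
  finally show ?thesis unfolding B_def M_def I'_def .
qed

section \<open>The stopping rule\<close>

lemma set_take_sorted_less:
  assumes "sorted (map f xs)" "distinct xs"
  shows "set (take (card {a \<in> set xs. f a < (\<rho>::real)}) xs) = {a \<in> set xs. f a < \<rho>}"
proof -
  have tw: "takeWhile (\<lambda>a. f a < \<rho>) xs = filter (\<lambda>a. f a < \<rho>) xs"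
    using assms(1)
  proof (induction xs)
    case (Cons a xs)
    show ?case
    proof (cases "f a < \<rho>")
      case False
      then have "filter (\<lambda>a. f a < \<rho>) xs = []" using Cons(2) by (fastforce simp: filter_empty_conv)
      then show ?thesis using False by simp
    qed (use Cons in simp)
  qed simp
  have "card {a \<in> set xs. f a < \<rho>} = length (takeWhile (\<lambda>a. f a < \<rho>) xs)"
    using assms(2) unfolding tw by (simp flip: set_filter distinct_card)
  then show ?thesis using takeWhile_eq_take[of "\<lambda>a. f a < \<rho>" xs] tw by (metis set_filter)
qed

lemma set_take_sorted_le:
  fixes f :: "'a \<Rightarrow> real"
  assumes "sorted (map f xs)" "distinct xs" "inj_on f (set xs)" "1 \<le> k" "k \<le> length xs"
  shows "set (take k xs) = {a \<in> set xs. f a \<le> f (xs ! (k - 1))}"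
proof -
  have le: "f (xs ! i) \<le> f (xs ! j)" if "i \<le> j" "j < length xs" for i j
    using sorted_nth_mono[OF assms(1), of i j] that by simp
  have "i < k \<longleftrightarrow> f (xs ! i) \<le> f (xs ! (k - 1))" if i: "i < length xs" for i
  proof (cases "i < k")
    case True
    then show ?thesis using le[of i "k - 1"] assms by auto
  next
    case False
    then have "xs ! i \<noteq> xs ! (k - 1)" using assms i by (subst nth_eq_iff_index_eq) auto
    then have "f (xs ! i) \<noteq> f (xs ! (k - 1))" using assms i by (auto dest!: inj_onD)
    moreover have "f (xs ! (k - 1)) \<le> f (xs ! i)" using False i by (intro le) auto
    ultimately show ?thesis using False by auto
  qed
  note iff = this
  have "set (take k xs) = (!) xs ` {i. i < k}"
    using assms(5) nth_image[of k xs] by (simp add: lessThan_def atLeast0LessThan)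
  also have "\<dots> = {a \<in> set xs. f a \<le> f (xs ! (k - 1))}"
  proof (intro set_eqI iffI)
    fix a assume "a \<in> (!) xs ` {i. i < k}"
    then obtain i where "i < k" "a = xs ! i" by auto
    then show "a \<in> {a \<in> set xs. f a \<le> f (xs ! (k - 1))}" using iff[of i] assms(5) by simp
  next
    fix a assume a: "a \<in> {a \<in> set xs. f a \<le> f (xs ! (k - 1))}"
    then obtain i where "i < length xs" "a = xs ! i" by (auto simp: in_set_conv_nth)
    then show "a \<in> (!) xs ` {i. i < k}" using iff[of i] a by simp
  qed
  finally show ?thesis .
qed

lemma nn_count_eq_card:
  assumes "distinct xs"
  shows "nn_count xs g k = card {a \<in> set (take k xs). fst a = g}"
  unfolding nn_count_def using distinct_card[of "filter (\<lambda>a. fst a = g) (take k xs)"] assms by simp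

lemma sum_nn_label:
  assumes "distinct xs"
  shows "(\<Sum>j = 1..nn_count xs g k. nn_label \<omega> xs g j)
    = (\<Sum>a | a \<in> set (take k xs) \<and> fst a = g. of_bool (snd (\<omega> a)))"
proof -
  define l where "l = filter (\<lambda>a. fst a = g) (take k xs)"
  have l: "filter (\<lambda>a. fst a = g) xs = l @ filter (\<lambda>a. fst a = g) (drop k xs)"
    unfolding l_def by (metis append_take_drop_id filter_append)
  have N: "nn_count xs g k = length l" unfolding nn_count_def l_def ..
  have "(\<Sum>j = 1..nn_count xs g k. nn_label \<omega> xs g j) = (\<Sum>j<length l. of_bool (snd (\<omega> (l ! j))))"
    unfolding N One_nat_def sum.atLeast1_atMost_eq nn_label_def l
    by (intro sum.cong) (auto simp: nth_append)
  also have "\<dots> = (\<Sum>a\<leftarrow>l. of_bool (snd (\<omega> a)))"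
    by (simp add: sum_list_sum_nth atLeast0LessThan)
  also have "\<dots> = (\<Sum>a\<in>set l. of_bool (snd (\<omega> a)))"
    using assms by (intro sum_list_distinct_conv_sum_set) (simp add: l_def)
  also have "set l = {a. a \<in> set (take k xs) \<and> fst a = g}" by (auto simp: l_def)
  finally show ?thesis .
qed

lemma eta_hat_signal:
  fixes \<omega> :: "'m::finite option \<times> nat \<Rightarrow> (real^'d) \<times> bool"
    and k :: nat
  assumes "distinct xs"
  defines "W \<equiv> (\<lambda>g. \<Sum>a | a \<in> set (take k xs) \<and> fst a = g. of_bool (snd (\<omega> a)) - 1/2 :: real)"
    and "N \<equiv> (\<lambda>g. real (card {a \<in> set (take k xs). fst a = g}))"
  shows "of_bool (eta_hat \<omega> xs g k \<ge> 1/2) * real (nn_count xs g k) * (eta_hat \<omega> xs g k - 1/2)\<^sup>2 = (max 0 (1 * W g))\<^sup>2 / N g"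
    and "of_bool (eta_hat \<omega> xs g k < 1/2) * real (nn_count xs g k) * (eta_hat \<omega> xs g k - 1/2)\<^sup>2 = (max 0 (- 1 * W g))\<^sup>2 / N g"
proof -
  have N: "real (nn_count xs g k) = N g" using nn_count_eq_card[OF assms(1)] by (simp add: N_def)
  have d: "eta_hat \<omega> xs g k - 1/2 = W g / N g" if "N g \<noteq> 0"
  proof -
    have "W g = (\<Sum>a | a \<in> set (take k xs) \<and> fst a = g. of_bool (snd (\<omega> a))) - N g / 2"
      unfolding W_def N_def by (simp add: sum_subtractf)
    then show ?thesis using that N unfolding eta_hat_def sum_nn_label[OF assms(1)]
      by (auto simp: diff_divide_distrib)
  qed
  have "N g * (W g / N g)\<^sup>2 = (W g)\<^sup>2 / N g" by (simp add: power2_eq_square)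
  moreover have "N g \<ge> 0" by (simp add: N_def)
  moreover have "eta_hat \<omega> xs g k \<ge> 1/2 \<longleftrightarrow> W g \<ge> 0" if "N g > 0"
    using d that by (smt (verit) divide_nonneg_pos divide_neg_pos)
  ultimately show "of_bool (eta_hat \<omega> xs g k \<ge> 1/2) * real (nn_count xs g k) * (eta_hat \<omega> xs g k - 1/2)\<^sup>2 = (max 0 (1 * W g))\<^sup>2 / N g"
    and "of_bool (eta_hat \<omega> xs g k < 1/2) * real (nn_count xs g k) * (eta_hat \<omega> xs g k - 1/2)\<^sup>2 = (max 0 (- 1 * W g))\<^sup>2 / N g"
    using d unfolding N by (cases "N g = 0"; force simp: max_def not_le)+
qed

lemma sum_UNIV_option: "(\<Sum>g\<in>(UNIV :: 'm::finite option set). f g) = f None + (\<Sum>i\<in>UNIV. f (Some i))"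
  unfolding UNIV_option_conv by (subst sum.insert) (auto simp: sum.reindex)

lemma r_plus_eq_directed_signal:
  assumes "distinct xs"
  shows "r_plus \<omega> xs k = directed_signal 1 (set (take k xs)) (\<lambda>a. snd (\<omega> a))"
  unfolding r_plus_def directed_signal_def sum_UNIV_option eta_hat_signal(1)[OF assms] ..

lemma r_minus_eq_directed_signal:
  assumes "distinct xs"
  shows "r_minus \<omega> xs k = directed_signal (- 1) (set (take k xs)) (\<lambda>a. snd (\<omega> a))"
  unfolding r_minus_def directed_signal_def sum_UNIV_option eta_hat_signal(2)[OF assms] ..

lemma card_sample_indices: "card (sample_indices nP nQ) = total_size nP nQ"
  unfolding sample_indices_def total_size_def by (subst card_SigmaI) (auto simp: sum_UNIV_option)

text \<open>
  The observations in the ball form one of the neighbourhoods examined by the rule, and its signal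
  exceeds the threshold; hence the rule stops there or earlier, at a neighbourhood inside the ball.
  There the wrong signal is below the threshold, so the signal that caused the stop is the right one.
\<close>
lemma classifier_correct:
  fixes \<omega> :: "'m::finite option \<times> nat \<Rightarrow> (real^'d) \<times> bool"
    and nP :: "'m \<Rightarrow> nat" and nQ :: nat
  defines "I \<equiv> sample_indices nP nQ" and "L \<equiv> (real CARD('d) + 3) * ln (real (total_size nP nQ))"
  assumes n: "total_size nP nQ \<ge> 1"
    and xs: "nn_ranking nP nQ \<omega> x xs" and k: "k_star nP nQ \<omega> xs k"
    and noties: "\<forall>a\<in>I. \<forall>b\<in>I. a \<noteq> b \<longrightarrow> dist x (fst (\<omega> a)) \<noteq> dist x (fst (\<omega> b))"
    and s: "\<bar>s\<bar> = 1"
    and strong: "directed_signal s {a \<in> I. dist x (fst (\<omega> a)) < \<rho>} (\<lambda>a. snd (\<omega> a)) > L"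
    and honest: "\<not> misleading I s L \<rho> x \<omega>"
  shows "f_hat \<omega> xs k \<longleftrightarrow> s = 1"
proof -
  let ?f = "\<lambda>a. dist x (fst (\<omega> a))"
  let ?y = "\<lambda>a. snd (\<omega> a)"
  have one: "s = 1 \<or> s = - 1" using s by auto
  have xs': "distinct xs" "set xs = I" "sorted (map ?f xs)" using xs unfolding nn_ranking_def I_def by auto
  have len: "length xs = total_size nP nQ" using distinct_card[OF xs'(1)] xs'(2) card_sample_indices unfolding I_def by metis
  have L: "L \<ge> 0" unfolding L_def using n by simp
  have fin: "finite I" unfolding I_def by (rule finite_sample_indices)
  define k0 where "k0 = card {a \<in> I. ?f a < \<rho>}"
  have near: "set (take k0 xs) = {a \<in> I. ?f a < \<rho>}"
    using set_take_sorted_less[OF xs'(3,1), of \<rho>] unfolding xs'(2) k0_def .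
  have r: "r_plus \<omega> xs k = directed_signal 1 (set (take k xs)) ?y" "r_minus \<omega> xs k = directed_signal (- 1) (set (take k xs)) ?y" for k
    using r_plus_eq_directed_signal[OF xs'(1)] r_minus_eq_directed_signal[OF xs'(1)] by auto
  have "k0 \<noteq> 0"
  proof
    assume "k0 = 0"
    then have e: "{a \<in> I. ?f a < \<rho>} = {}" using fin unfolding k0_def by simp
    show False using strong L unfolding e by (simp add: directed_signal_def)
  qed
  moreover have "k0 \<le> total_size nP nQ"
    unfolding k0_def card_sample_indices[symmetric] I_def by (intro card_mono finite_sample_indices) auto
  ultimately have k0: "k0 \<in> {1..total_size nP nQ}" by auto
  have exc: "r_hat \<omega> xs k0 > L"
    using strong one unfolding r_hat_def r near by (auto simp: less_max_iff_disj)
  have kk: "k \<in> {1..total_size nP nQ}" "r_hat \<omega> xs k > L" "k \<le> k0"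
    using k k0 exc unfolding k_star_def Let_def L_def[symmetric] by (auto split: if_splits)
  define b where "b = xs ! (k - 1)"
  have bI: "b \<in> I" unfolding b_def xs'(2)[symmetric] using kk len by (intro nth_mem) auto
  have "b \<in> set (take k0 xs)"
    unfolding b_def using kk k0 len by (auto simp: set_conv_nth intro!: exI[of _ "k - 1"])
  then have b_near: "?f b < \<rho>" unfolding near by simp
  \<comment> \<open>Without ties, the first \<open>k\<close> entries are exactly the observations no farther away than the last of them.\<close>
  have take_k: "set (take k xs) = {a \<in> I. ?f a \<le> ?f b}"
    using set_take_sorted_le[OF xs'(3,1), of k] noties kk len unfolding xs'(2) b_def inj_on_def by auto
  have wrong: "directed_signal (- s) (set (take k xs)) ?y \<le> L"
    using honest bI b_near unfolding misleading_def take_k by (meson not_le)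
  then show ?thesis using kk(2) one unfolding f_hat_def r_hat_def r by (auto simp: less_max_iff_disj)
qed

section \<open>Excess risk\<close>

text \<open>
  At each covariate the two possible predictions err with conditional probabilities \<open>\<eta> x\<close> and
  \<open>1 - \<eta> x\<close>, which differ by \<open>\<bar>2 \<eta> x - 1\<bar>\<close>, and the Bayes classifier takes the smaller one.
\<close>
lemma excess_risk_eq:
  fixes Q :: "((real^'d) \<times> bool) measure"
  assumes Q: "population Q" and \<eta>: "regression_function Q \<eta>" and f: "Measurable.pred borel f"
  shows "ennreal (excess_risk Q \<eta> f)
      = (\<integral>\<^sup>+ x. ennreal (\<bar>2 * \<eta> x - 1\<bar> * of_bool (f x \<noteq> bayes_classifier \<eta> x)) \<partial>covariate_law Q)"
    and "excess_risk Q \<eta> f \<ge> 0"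
proof -
  interpret Q: prob_space Q by (rule population_D[OF Q])
  note \<eta>01 = regression_functionD(2,3)[OF \<eta>]
  have \<eta>m [measurable]: "\<eta> \<in> borel_measurable borel" by (rule regression_functionD(1)[OF \<eta>])
  have sH [measurable_cong]: "sets (covariate_law Q) = sets borel" by (rule population_D[OF Q])
  have bm [measurable]: "Measurable.pred borel (bayes_classifier \<eta>)" unfolding bayes_classifier_def by measurable
  have risk: "ennreal (risk Q f) = (\<integral>\<^sup>+ x. ennreal (if f x then 1 - \<eta> x else \<eta> x) \<partial>covariate_law Q)"
    if [measurable]: "Measurable.pred borel f" for f
  proof -
    have [measurable]: "fst \<in> Q \<rightarrow>\<^sub>M borel" "snd \<in> Q \<rightarrow>\<^sub>M count_space UNIV" by (rule population_D[OF Q])+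
    have S [measurable]: "{z \<in> space Q. snd z \<noteq> f (fst z)} \<in> sets Q" by measurable
    have "ennreal (risk Q f) = (\<integral>\<^sup>+ z. indicator {z \<in> space Q. snd z \<noteq> f (fst z)} z \<partial>Q)"
      unfolding risk_def using S by (simp add: Q.emeasure_eq_measure)
    also have "\<dots> = (\<integral>\<^sup>+ x. ennreal (\<eta> x) * indicator {z \<in> space Q. snd z \<noteq> f (fst z)} (x, True) + ennreal (1 - \<eta> x) * indicator {z \<in> space Q. snd z \<noteq> f (fst z)} (x, False) \<partial>covariate_law Q)"
      by (rule nn_integral_population[OF Q \<eta>]) (rule borel_measurable_indicator[OF S])
    also have "\<dots> = (\<integral>\<^sup>+ x. ennreal (if f x then 1 - \<eta> x else \<eta> x) \<partial>covariate_law Q)"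
      by (intro nn_integral_cong) (auto simp: indicator_def population_D(3)[OF Q])
    finally show ?thesis .
  qed
  define E where "E = (\<integral>\<^sup>+ x. ennreal (\<bar>2 * \<eta> x - 1\<bar> * of_bool (f x \<noteq> bayes_classifier \<eta> x)) \<partial>covariate_law Q)"
  note [measurable] = f
  have "ennreal (risk Q f) = (\<integral>\<^sup>+ x. ennreal (if bayes_classifier \<eta> x then 1 - \<eta> x else \<eta> x) + ennreal (\<bar>2 * \<eta> x - 1\<bar> * of_bool (f x \<noteq> bayes_classifier \<eta> x)) \<partial>covariate_law Q)"
    unfolding risk[OF f]
  proof (rule nn_integral_cong)
    fix x
    have "(if f x then 1 - \<eta> x else \<eta> x) = (if bayes_classifier \<eta> x then 1 - \<eta> x else \<eta> x) + \<bar>2 * \<eta> x - 1\<bar> * of_bool (f x \<noteq> bayes_classifier \<eta> x)"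
      by (auto simp: bayes_classifier_def)
    then show "ennreal (if f x then 1 - \<eta> x else \<eta> x) = ennreal (if bayes_classifier \<eta> x then 1 - \<eta> x else \<eta> x) + ennreal (\<bar>2 * \<eta> x - 1\<bar> * of_bool (f x \<noteq> bayes_classifier \<eta> x))"
      using \<eta>01[of x] by (simp only:) (rule ennreal_plus, auto)
  qed
  also have "\<dots> = ennreal (risk Q (bayes_classifier \<eta>)) + E"
    unfolding risk[OF bm] E_def by (intro nn_integral_add) measurable
  finally have e: "ennreal (risk Q f) = ennreal (risk Q (bayes_classifier \<eta>)) + E" .
  have r0: "risk Q f \<ge> 0" for f unfolding risk_def by simp
  have "ennreal (risk Q (bayes_classifier \<eta>)) \<le> ennreal (risk Q f)" unfolding e by simp
  then show ge: "excess_risk Q \<eta> f \<ge> 0" using r0 unfolding excess_risk_def by simp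
  have "ennreal (excess_risk Q \<eta> f) = ennreal (risk Q f) - ennreal (risk Q (bayes_classifier \<eta>))"
    unfolding excess_risk_def by (rule ennreal_minus[symmetric, OF r0])
  also have "\<dots> = E" unfolding e by simp
  finally show "ennreal (excess_risk Q \<eta> f) = (\<integral>\<^sup>+ x. ennreal (\<bar>2 * \<eta> x - 1\<bar> * of_bool (f x \<noteq> bayes_classifier \<eta> x)) \<partial>covariate_law Q)"
    unfolding E_def .
qed

text \<open>
  Fubini exchanges the data with the query point. Below the margin \<open>t\<close> the excess is at most
  \<open>2 t\<close> even if the prediction is always wrong; above it the probability of an error is used.
\<close>
lemma expected_excess_risk_le:
  fixes Q :: "((real^'d) \<times> bool) measure" and P :: "'m::finite \<Rightarrow> ((real^'d) \<times> bool) measure"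
  assumes P: "\<And>i. population (P i)" and Q: "population Q" and \<eta>: "regression_function Q \<eta>"
    and f: "(\<lambda>(\<omega>, x). f \<omega> x) \<in> measurable (data_space nP nQ \<Otimes>\<^sub>M borel) (count_space UNIV)"
    and t: "t \<ge> 0" and p: "p \<ge> 0"
    and wrong: "\<And>x. t \<le> \<bar>\<eta> x - 1/2\<bar> \<Longrightarrow> 0 < \<bar>\<eta> x - 1/2\<bar> \<Longrightarrow>
      emeasure (data_law P Q nP nQ) {\<omega> \<in> space (data_law P Q nP nQ). f \<omega> x \<noteq> bayes_classifier \<eta> x} \<le> ennreal p"
  shows "expected_excess_risk P Q \<eta> nP nQ f
    \<le> 2 * t * measure (covariate_law Q) {x. 0 < \<bar>\<eta> x - 1/2\<bar> \<and> \<bar>\<eta> x - 1/2\<bar> < t} + p"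
proof -
  define M where "M = (\<lambda>a::'m option \<times> nat. case_option Q P (fst a))"
  define I where "I = sample_indices nP nQ"
  have data: "data_law P Q nP nQ = PiM I M" unfolding data_law_def M_def I_def
    by (intro arg_cong2[where f = PiM]) (auto simp: fun_eq_iff)
  have pM: "population (M a)" for a unfolding M_def using P Q by (auto split: option.split)
  have prM: "prob_space (PiM I M)" by (intro prob_space_PiM population_D(1)[OF pM])
  interpret PM: prob_space "PiM I M" by (rule prM)
  define H where "H = covariate_law Q"
  interpret H: prob_space H unfolding H_def by (rule population_D[OF Q])
  have sH [measurable_cong]: "sets H = sets borel" unfolding H_def by (rule population_D[OF Q])
  interpret PS: pair_sigma_finite "PiM I M" H ..
  have \<eta>m [measurable]: "\<eta> \<in> borel_measurable borel" by (rule regression_functionD(1)[OF \<eta>])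
  note \<eta>01 = regression_functionD(2,3)[OF \<eta>]
  have bm [measurable]: "Measurable.pred borel (bayes_classifier \<eta>)" unfolding bayes_classifier_def by measurable
  have sD: "sets (data_space nP nQ :: ('m option \<times> nat \<Rightarrow> (real^'d) \<times> bool) measure) = sets (PiM I M)"
    unfolding data_space_def I_def
    by (rule sets_PiM_cong) (auto simp: population_D(2)[OF pM] obs_space_def)
  have fm [measurable]: "(\<lambda>z. f (fst z) (snd z)) \<in> measurable (PiM I M \<Otimes>\<^sub>M H) (count_space UNIV)"
    using f unfolding measurable_cong_sets[OF sets_pair_measure_cong[OF sD sH[symmetric]] refl] by (simp add: case_prod_beta)
  have f1 [measurable]: "Measurable.pred borel (f \<omega>)" if "\<omega> \<in> space (PiM I M)" for \<omega>
  proof -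
    have "(\<lambda>x. f (fst (\<omega>, x)) (snd (\<omega>, x))) \<in> measurable H (count_space UNIV)"
      using that by (intro measurable_compose[OF _ fm]) auto
    then show ?thesis unfolding measurable_cong_sets[OF sH refl] by simp
  qed
  have f2: "{\<omega> \<in> space (PiM I M). f \<omega> x \<noteq> bayes_classifier \<eta> x} \<in> sets (PiM I M)" for x
  proof -
    have "(\<lambda>\<omega>. f (fst (\<omega>, x)) (snd (\<omega>, x))) \<in> measurable (PiM I M) (count_space UNIV)"
      using sets_eq_imp_space_eq[OF sH] by (intro measurable_compose[OF _ fm]) auto
    then have [measurable]: "(\<lambda>\<omega>. f \<omega> x) \<in> measurable (PiM I M) (count_space UNIV)" by simp
    show ?thesis by measurable
  qed
  define U where "U = {x. 0 < \<bar>\<eta> x - 1/2\<bar> \<and> \<bar>\<eta> x - 1/2\<bar> < t}"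
  have U [measurable]: "U \<in> sets borel" unfolding U_def by measurable
  define B where "B = 2 * t * measure H U + p"
  have B0: "B \<ge> 0" unfolding B_def using t p by simp
  have "(\<integral>\<^sup>+ \<omega>. ennreal (excess_risk Q \<eta> (f \<omega>)) \<partial>PiM I M)
    = (\<integral>\<^sup>+ \<omega>. (\<integral>\<^sup>+ x. ennreal (\<bar>2 * \<eta> x - 1\<bar> * of_bool (f \<omega> x \<noteq> bayes_classifier \<eta> x)) \<partial>H) \<partial>PiM I M)"
    unfolding H_def by (intro nn_integral_cong excess_risk_eq(1)[OF Q \<eta>] f1)
  also have "\<dots> = (\<integral>\<^sup>+ x. (\<integral>\<^sup>+ \<omega>. ennreal (\<bar>2 * \<eta> x - 1\<bar> * of_bool (f \<omega> x \<noteq> bayes_classifier \<eta> x)) \<partial>PiM I M) \<partial>H)"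
    by (rule PS.Fubini'[symmetric]) measurable
  also have "\<dots> \<le> (\<integral>\<^sup>+ x. ennreal (2 * t) * indicator U x + ennreal p \<partial>H)"
  proof (rule nn_integral_mono)
    fix x
    have "(\<integral>\<^sup>+ \<omega>. ennreal (\<bar>2 * \<eta> x - 1\<bar> * of_bool (f \<omega> x \<noteq> bayes_classifier \<eta> x)) \<partial>PiM I M)
      = (\<integral>\<^sup>+ \<omega>. ennreal \<bar>2 * \<eta> x - 1\<bar> * indicator {\<omega> \<in> space (PiM I M). f \<omega> x \<noteq> bayes_classifier \<eta> x} \<omega> \<partial>PiM I M)"
      by (intro nn_integral_cong) (auto simp: indicator_def)
    also have "\<dots> = ennreal \<bar>2 * \<eta> x - 1\<bar> * emeasure (PiM I M) {\<omega> \<in> space (PiM I M). f \<omega> x \<noteq> bayes_classifier \<eta> x}"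
      using f2 by (rule nn_integral_cmult_indicator)
    also have "\<dots> \<le> ennreal (2 * t) * indicator U x + ennreal p"
    proof (cases "t \<le> \<bar>\<eta> x - 1/2\<bar> \<and> 0 < \<bar>\<eta> x - 1/2\<bar>")
      case True
      have "ennreal \<bar>2 * \<eta> x - 1\<bar> * emeasure (PiM I M) {\<omega> \<in> space (PiM I M). f \<omega> x \<noteq> bayes_classifier \<eta> x} \<le> 1 * ennreal p"
        using wrong[of x] True \<eta>01[of x] unfolding data by (intro mult_mono) (auto simp: abs_le_iff)
      then show ?thesis by (simp add: add_increasing)
    next
      case False
      show ?thesis
      proof (cases "\<bar>\<eta> x - 1/2\<bar> = 0")
        case True
        then have "\<bar>2 * \<eta> x - 1\<bar> = 0" by simp
        then show ?thesis by simp
      next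
        case nz: False
        then have xU: "x \<in> U" using False by (auto simp: U_def)
        have "ennreal \<bar>2 * \<eta> x - 1\<bar> * emeasure (PiM I M) {\<omega> \<in> space (PiM I M). f \<omega> x \<noteq> bayes_classifier \<eta> x} \<le> ennreal (2 * t) * 1"
        proof (intro mult_mono PM.emeasure_le_1 ennreal_leI)
          show "\<bar>2 * \<eta> x - 1\<bar> \<le> 2 * t" using xU unfolding U_def by (auto simp: abs_if split: if_splits)
        qed auto
        then show ?thesis using xU by (simp add: add_increasing2)
      qed
    qed
    finally show "(\<integral>\<^sup>+ \<omega>. ennreal (\<bar>2 * \<eta> x - 1\<bar> * of_bool (f \<omega> x \<noteq> bayes_classifier \<eta> x)) \<partial>PiM I M) \<le> ennreal (2 * t) * indicator U x + ennreal p" .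
  qed
  also have "\<dots> = ennreal (2 * t) * emeasure H U + ennreal p"
    by (subst nn_integral_add) (auto simp: nn_integral_cmult_indicator sH H.emeasure_space_1)
  also have "\<dots> = ennreal B"
    unfolding B_def H.emeasure_eq_measure using t p by (simp flip: ennreal_mult ennreal_plus)
  finally have le: "(\<integral>\<^sup>+ \<omega>. ennreal (excess_risk Q \<eta> (f \<omega>)) \<partial>PiM I M) \<le> ennreal B" .
  have "(\<integral>\<omega>. excess_risk Q \<eta> (f \<omega>) \<partial>PiM I M) \<le> B"
  \<comment> \<open>A Bochner integral that does not exist is \<open>0\<close> by convention.\<close>
  proof (cases "integrable (PiM I M) (\<lambda>\<omega>. excess_risk Q \<eta> (f \<omega>))")
    case True
    have "ennreal (\<integral>\<omega>. excess_risk Q \<eta> (f \<omega>) \<partial>PiM I M) = (\<integral>\<^sup>+ \<omega>. ennreal (excess_risk Q \<eta> (f \<omega>)) \<partial>PiM I M)"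
      by (rule nn_integral_eq_integral[symmetric, OF True]) (auto intro!: AE_I2 excess_risk_eq(2)[OF Q \<eta>] f1)
    then show ?thesis using le ennreal_le_iff[OF B0] by metis
  next
    case False
    then show ?thesis using B0 by (simp add: not_integrable_integral_eq)
  qed
  then show ?thesis unfolding expected_excess_risk_def data B_def U_def H_def .
qed

section \<open>Error probability at a point\<close>

lemma card_sample_fibre: "card {a \<in> sample_indices nP nQ. fst a = g} = case_option nQ nP g"
proof -
  have "{a \<in> sample_indices nP nQ. fst a = g} = Pair g ` {..<case_option nQ nP g}"
    unfolding sample_indices_def by auto
  then show ?thesis by (simp add: card_image inj_on_def)
qed

text \<open>
  Both bad events have probability at most of order \<open>1/n\<^sup>2\<close>. The constant \<open>d + 5\<close> in the budget pays for the
  threshold \<open>(d + 3) ln n\<close> and for a further \<open>2 ln n\<close> in the exponent; the factor \<open>8\<close> is the one in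
  \<open>prob_weak_signal\<close>.
\<close>
lemma prob_misclassified:
  fixes D :: "'m::finite option \<Rightarrow> ((real^'d) \<times> bool) measure"
  assumes n: "total_size nP nQ \<ge> 2"
    and clf: "data_driven_classifier nP nQ fa"
    and pop: "\<And>g. population (D g)" and reg: "\<And>g. regression_function (D g) (\<eta> g)"
    and sph: "\<And>g r. emeasure (covariate_law (D g)) (sphere x r) = 0"
    and s: "\<bar>s\<bar> = 1" and same: "\<And>g z. dist x z < \<rho> \<Longrightarrow> s * (\<eta> g z - 1/2) \<ge> 0"
    and \<tau>: "0 \<le> \<tau>" "\<tau> \<le> 1/2"
    and p: "0 \<le> p" "p \<le> measure (covariate_law (D g)) (ball x \<rho>)"
    and gain: "AE z in covariate_law (D g). dist x z < \<rho> \<longrightarrow> s * (\<eta> g z - 1/2) \<ge> \<tau>"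
    and budget: "8 * (real CARD('d) + 5) * ln (real (total_size nP nQ)) \<le> real (case_option nQ nP g) * p * \<tau>\<^sup>2"
  defines "M \<equiv> PiM (sample_indices nP nQ) (\<lambda>a. D (fst a))"
  shows "emeasure M {\<omega> \<in> space M. fa \<omega> x \<noteq> (s = 1)}
    \<le> ennreal ((exp (real CARD('m option) / 2) + 1) / (real (total_size nP nQ))\<^sup>2)"
proof -
  define I where "I = sample_indices nP nQ"
  define n where "n = real (total_size nP nQ)"
  have n2: "n \<ge> 2" using n by (simp add: n_def)
  define L where "L = (real CARD('d) + 3) * ln n"
  have fin: "finite I" unfolding I_def by (rule finite_sample_indices)
  define A where "A = {\<omega> \<in> space M. misleading I s L \<rho> x \<omega>}"
  define B where "B = {\<omega> \<in> space M. directed_signal s {a \<in> I. dist x (fst (\<omega> a)) < \<rho>} (\<lambda>a. snd (\<omega> a)) \<le> L}"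
  have pM: "population (D (fst a))" for a :: "'m option \<times> nat" by (rule pop)
  have sp: "space M = space (data_space nP nQ :: ('m option \<times> nat \<Rightarrow> (real^'d) \<times> bool) measure)"
    unfolding data_space_def M_def
    by (intro sets_eq_imp_space_eq sets_PiM_cong) (auto simp: population_D(2)[OF pop] obs_space_def)
  have A: "A \<in> sets M"
    unfolding A_def M_def I_def[symmetric]
    using measurable_misleading[of "\<lambda>a. D (fst a)", OF pop fin] by (auto simp: pred_def)
  have B: "B \<in> sets M"
  proof -
    have "(\<lambda>w. directed_signal s {a \<in> I. dist x (fst (w a)) < \<rho>} (\<lambda>a. snd (w a))) \<in> borel_measurable M"
      unfolding M_def I_def[symmetric]
    proof (rule measurable_directed_signal[OF fin, where y = "\<lambda>w a. snd (w a)"])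
      fix a assume a: "a \<in> I"
      note [measurable] = measurable_observation[of "\<lambda>a. D (fst a)", OF pop a]
      show "Measurable.pred (PiM I (\<lambda>a. D (fst a))) (\<lambda>w. dist x (fst (w a)) < \<rho>)" by measurable
      show "Measurable.pred (PiM I (\<lambda>a. D (fst a))) (\<lambda>w. snd (w a))" by measurable
    qed
    note [measurable] = this
    show ?thesis unfolding B_def by measurable
  qed
  have ex: "exp (- (2 * ln n)) = 1 / n\<^sup>2"
    using n2 by (simp add: exp_minus exp_of_nat_mult[of 2, simplified] inverse_eq_divide)
  have pA: "emeasure M A \<le> ennreal (exp (real CARD('m option) / 2) / n\<^sup>2)"
  proof -
    have "emeasure M A \<le> ennreal (real (card I) * exp (real CARD('m option) / 2 - L))"
      unfolding A_def M_def I_def[symmetric] by (rule prob_misleading[OF fin pop reg s same])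
    also have "\<dots> \<le> ennreal (exp (real CARD('m option) / 2) / n\<^sup>2)"
    proof (rule ennreal_leI)
      have ln: "ln n \<ge> 0" using n2 by simp
      have "real (card I) = exp (ln n)" using n2 by (simp add: I_def card_sample_indices n_def)
      then have "real (card I) * exp (real CARD('m option) / 2 - L) = exp (real CARD('m option) / 2 + (ln n - L))"
        by (simp flip: exp_add add: algebra_simps)
      also have "\<dots> \<le> exp (real CARD('m option) / 2 + - (2 * ln n))"
      proof -
        have "0 \<le> real CARD('d) * ln n" using ln by simp
        then have "ln n - L \<le> - (2 * ln n)" unfolding L_def by (simp add: algebra_simps)
        then show ?thesis by simp
      qed
      also have "\<dots> = exp (real CARD('m option) / 2) / n\<^sup>2" unfolding exp_add ex by simp
      finally show "real (card I) * exp (real CARD('m option) / 2 - L) \<le> exp (real CARD('m option) / 2) / n\<^sup>2" .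
    qed
    finally show ?thesis .
  qed
  have pB: "emeasure M B \<le> ennreal (1 / n\<^sup>2)"
  proof -
    have "emeasure M B \<le> ennreal (exp (L - real (card {a \<in> I. fst a = g}) * p * \<tau>\<^sup>2 / 8))"
      unfolding B_def M_def I_def[symmetric] 
      by (rule prob_weak_signal[of I D g "\<eta> g" s \<tau> p x \<rho>, OF fin pop reg s \<tau> p gain])
    also have "\<dots> \<le> ennreal (exp (- (2 * ln n)))"
      using budget unfolding I_def card_sample_fibre L_def n_def by (intro ennreal_leI) (simp add: algebra_simps)
    finally show ?thesis unfolding ex .
  qed
  have "AE \<omega> in M. \<forall>a\<in>I. \<forall>b\<in>I. a \<noteq> b \<longrightarrow> dist x (fst (\<omega> a)) \<noteq> dist x (fst (\<omega> b))"
    unfolding M_def I_def[symmetric] by (rule AE_distinct_distances[OF fin pop sph])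
  then have "AE \<omega> in M. \<omega> \<in> {\<omega> \<in> space M. fa \<omega> x \<noteq> (s = 1)} \<longrightarrow> \<omega> \<in> A \<union> B"
  proof eventually_elim
    case (elim \<omega>)
    show ?case
    proof (intro impI, rule ccontr)
      assume \<omega>: "\<omega> \<in> {\<omega> \<in> space M. fa \<omega> x \<noteq> (s = 1)}" and "\<omega> \<notin> A \<union> B"
      then have ok: "\<not> misleading I s L \<rho> x \<omega>" "directed_signal s {a \<in> I. dist x (fst (\<omega> a)) < \<rho>} (\<lambda>a. snd (\<omega> a)) > L"
        by (auto simp: A_def B_def)
      obtain xs k where xk: "nn_ranking nP nQ \<omega> x xs" "k_star nP nQ \<omega> xs k" "fa \<omega> x = f_hat \<omega> xs k"
        using clf \<omega> sp unfolding data_driven_classifier_def by blast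
      have "f_hat \<omega> xs k \<longleftrightarrow> s = 1"
        by (rule classifier_correct[OF _ xk(1,2) _ s])
           (use elim ok n in \<open>auto simp: I_def L_def n_def\<close>)
      then show False using \<omega> xk(3) by auto
    qed
  qed
  then have "emeasure M {\<omega> \<in> space M. fa \<omega> x \<noteq> (s = 1)} \<le> emeasure M (A \<union> B)"
    using A B by (intro emeasure_mono_AE) auto
  also have "\<dots> \<le> emeasure M A + emeasure M B" by (rule emeasure_subadditive[OF A B])
  also have "\<dots> \<le> ennreal (exp (real CARD('m option) / 2) / n\<^sup>2) + ennreal (1 / n\<^sup>2)"
    by (rule add_mono[OF pA pB])
  also have "\<dots> = ennreal ((exp (real CARD('m option) / 2) + 1) / n\<^sup>2)"
    by (subst ennreal_plus[symmetric]) (auto simp: add_divide_distrib)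
  finally show ?thesis unfolding n_def .
qed

section \<open>Consequences of the density and regularity conditions\<close>

lemma density_between_sphere:
  assumes "density_between \<mu>lo \<mu>hi H"
  shows "emeasure H (sphere x r) = 0"
proof -
  obtain f where f: "f \<in> borel_measurable borel" "H = density lborel (\<lambda>x. ennreal (f x))"
    using assms unfolding density_between_def by blast
  have "sphere x r \<in> null_sets lborel"
    using negligible_sphere[of x r] by (auto simp: negligible_iff_null_sets null_sets_completion_iff borel_closed)
  then have "sphere x r \<in> null_sets H"
    unfolding f(2) using absolutely_continuousI_density[of "\<lambda>x. ennreal (f x)" lborel] f(1)
    by (auto simp: absolutely_continuous_def)
  then show ?thesis by auto
qed

text \<open>
  The density is bounded below only on the support, and the regularity condition says that the
  support fills a fixed fraction of the ball.
\<close>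
lemma density_between_ball:
  fixes H :: "(real^'d) measure"
  assumes "density_between \<mu>lo \<mu>hi H" "prob_space H" "\<mu>lo > 0"
    and "c\<mu> * measure lborel (ball x r) \<le> measure lborel (msupport H \<inter> ball x r)"
  shows "\<mu>lo * c\<mu> * measure lborel (ball x r) \<le> measure H (ball x r)"
proof -
  obtain f where f: "f \<in> borel_measurable borel" "H = density lborel (\<lambda>x. ennreal (f x))"
    "\<And>x. x \<in> msupport H \<Longrightarrow> \<mu>lo < f x"
    using assms(1) unfolding density_between_def by blast
  interpret H: prob_space H by (rule assms)
  define S where "S = msupport H \<inter> ball x r"
  have S: "S \<in> sets lborel" unfolding S_def using closed_msupport[of H] by (auto intro!: sets.Int borel_closed borel_open)
  have Sfin: "emeasure lborel S < \<infinity>"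
    using emeasure_mono[of S "ball x r" lborel] emeasure_lborel_ball_finite[of x r] unfolding S_def by (auto intro: le_less_trans)
  have "ennreal (\<mu>lo * measure lborel S) = ennreal \<mu>lo * emeasure lborel S"
    using Sfin assms(3) by (simp add: ennreal_mult emeasure_eq_ennreal_measure)
  also have "\<dots> = (\<integral>\<^sup>+ x. ennreal \<mu>lo * indicator S x \<partial>lborel)"
    using S by (simp add: nn_integral_cmult_indicator)
  also have "\<dots> \<le> (\<integral>\<^sup>+ x. ennreal (f x) * indicator S x \<partial>lborel)"
    using f(3) by (intro nn_integral_mono) (auto simp: S_def indicator_def intro: ennreal_leI less_imp_le)
  also have "\<dots> = emeasure H S" unfolding f(2) using f(1) S by (subst emeasure_density) auto
  also have "\<dots> = ennreal (measure H S)" by (rule H.emeasure_eq_measure)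
  finally have "\<mu>lo * measure lborel S \<le> measure H S" by (simp add: ennreal_le_iff)
  also have "\<dots> \<le> measure H (ball x r)"
    by (rule H.finite_measure_mono) (auto simp: S_def f(2))
  finally have "\<mu>lo * measure lborel S \<le> measure H (ball x r)" .
  moreover have "\<mu>lo * (c\<mu> * measure lborel (ball x r)) \<le> \<mu>lo * measure lborel S"
    using assms(3,4) unfolding S_def by (intro mult_left_mono) auto
  ultimately show ?thesis by (simp add: mult.assoc)
qed

section \<open>The rate\<close>

text \<open>
  At least one of the terms of \<open>S\<close> is as large as their mean. For that population the lower
  bound on \<open>\<zeta>\<close> is exactly what cancels the power of \<open>S\<close>, and the lower bounds on \<open>K\<close> leave the required
  constant \<open>A g\<close>. Here \<open>N g\<close> stands for a sample size divided by \<open>ln n\<close>.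
\<close>
lemma exists_informative_sample:
  fixes N A \<gamma> :: "'g::finite \<Rightarrow> real"
  assumes \<beta>: "\<beta> > 0" and d: "d > 0" and \<gamma>: "\<And>g. \<gamma> g > 0" and N: "\<And>g. N g \<ge> 0" and A: "\<And>g. A g > 0"
    and S: "S = (\<Sum>g\<in>UNIV. N g powr ((2 * \<beta> + d) / (2 * \<gamma> g * \<beta> + d)))" "S > 0"
    and K: "\<And>g. K \<ge> A g powr (\<beta> / (2 * \<gamma> g * \<beta> + d)) * real CARD('g) powr (\<beta> / (2 * \<beta> + d))"
    and \<zeta>: "\<zeta> \<ge> K * S powr (- (\<beta> / (2 * \<beta> + d)))"
  shows "\<exists>g. A g \<le> N g * \<zeta> powr ((2 * \<gamma> g * \<beta> + d) / \<beta>)"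
proof -
  define e where "e = (\<lambda>g. (2 * \<beta> + d) / (2 * \<gamma> g * \<beta> + d))"
  define u where "u = S / real CARD('g)"
  have u: "u > 0" unfolding u_def using S(2) by simp
  have pos: "2 * \<gamma> g * \<beta> + d > 0" for g using \<beta> d \<gamma>[of g] by (intro add_pos_pos mult_pos_pos) auto
  have pos': "2 * \<beta> + d > 0" using \<beta> d by simp
  have "\<exists>g. N g powr e g \<ge> u"
  proof (rule ccontr)
    assume "\<not> (\<exists>g. N g powr e g \<ge> u)"
    then have "(\<Sum>g\<in>UNIV. N g powr e g) < (\<Sum>g\<in>(UNIV::'g set). u)" by (intro sum_strict_mono) (auto simp: not_le)
    then show False using S unfolding e_def u_def by simp
  qed
  then obtain g where g: "N g powr e g \<ge> u" by blast
  have eg: "e g > 0" unfolding e_def using pos pos' by simp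
  have Ng: "N g > 0" using g u N[of g] by (cases "N g = 0") auto
  define \<theta> where "\<theta> = (2 * \<gamma> g * \<beta> + d) / \<beta>"
  have \<theta>: "\<theta> > 0" unfolding \<theta>_def using pos \<beta> by simp
  have "u powr (1 / e g) \<le> (N g powr e g) powr (1 / e g)"
    using g u eg by (intro powr_mono2) auto
  also have "\<dots> = N g" using eg Ng by (simp add: powr_powr)
  finally have 1: "u powr (1 / e g) \<le> N g" .
  have "A g powr (1 / \<theta>) * u powr (- (\<beta> / (2 * \<beta> + d)))
    = A g powr (\<beta> / (2 * \<gamma> g * \<beta> + d)) * real CARD('g) powr (\<beta> / (2 * \<beta> + d)) * S powr (- (\<beta> / (2 * \<beta> + d)))"
    using S(2) by (simp add: \<theta>_def u_def powr_divide powr_minus field_simps)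
  also have "\<dots> \<le> K * S powr (- (\<beta> / (2 * \<beta> + d)))" by (intro mult_right_mono K) auto
  also have "\<dots> \<le> \<zeta>" by (rule \<zeta>)
  finally have "(A g powr (1 / \<theta>) * u powr (- (\<beta> / (2 * \<beta> + d)))) powr \<theta> \<le> \<zeta> powr \<theta>"
    using \<theta> by (intro powr_mono2) auto
  moreover have "(A g powr (1 / \<theta>) * u powr (- (\<beta> / (2 * \<beta> + d)))) powr \<theta> = A g * u powr (- (1 / e g))"
  proof -
    have "- (\<beta> / (2 * \<beta> + d)) * \<theta> = - (1 / e g)" unfolding \<theta>_def e_def using \<beta> by simp
    then show ?thesis using A[of g] \<theta> by (simp add: powr_mult powr_powr)
  qed
  ultimately have 2: "A g * u powr (- (1 / e g)) \<le> \<zeta> powr \<theta>" by simp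
  have "A g = u powr (1 / e g) * (A g * u powr (- (1 / e g)))"
    using u by (simp add: powr_minus)
  also have "\<dots> \<le> N g * \<zeta> powr \<theta>"
    using 1 2 N A[of g] by (intro mult_mono) auto
  finally show ?thesis unfolding \<theta>_def by blast
qed

text \<open>
  The largest possible exponent in \<open>S\<close> is \<open>(2 \<beta> + d)/d\<close>, approached by small \<open>\<gamma> g\<close>, so that the rate
  can be as small as \<open>n powr (- (\<beta> + \<alpha> \<beta>)/d)\<close>. This is still of order at least \<open>1/n\<^sup>2\<close> because
  \<open>\<beta> \<le> 1 \<le> d\<close> and \<open>\<alpha> \<beta> \<le> d\<close>.
\<close>
lemma inverse_square_le_rate:
  fixes N \<gamma> :: "'g::finite \<Rightarrow> real"
  assumes \<beta>: "0 < \<beta>" "\<beta> \<le> 1" and d: "d \<ge> 1" and \<alpha>: "\<alpha> \<ge> 0" "\<alpha> * \<beta> \<le> d" and \<gamma>: "\<And>g. \<gamma> g > 0"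
    and n: "n \<ge> 2" and N: "\<And>g. 0 \<le> N g" "\<And>g. N g \<le> n / ln n"
    and S: "S = (\<Sum>g\<in>UNIV. N g powr ((2 * \<beta> + d) / (2 * \<gamma> g * \<beta> + d)))" "S > 0"
  defines "r \<equiv> \<beta> * (1 + \<alpha>) / (2 * \<beta> + d)"
  shows "1 / n\<^sup>2 \<le> 4 * real CARD('g) powr r * S powr (- r)"
proof -
  define e where "e = (2 * \<beta> + d) / d"
  have ln2: "ln n \<ge> 1/2"
  proof -
    have "1/2 \<le> ln (2::real)" using ln2_ge_two_thirds by simp
    also have "\<dots> \<le> ln n" using n by simp
    finally show ?thesis .
  qed
  have r: "r \<ge> 0" unfolding r_def using \<beta> d \<alpha> by simp
  have "S \<le> (\<Sum>g\<in>(UNIV::'g set). (2 * n) powr e)"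
    unfolding S(1)
  proof (rule sum_mono)
    fix g
    have pos: "2 * \<gamma> g * \<beta> > 0" using \<beta> \<gamma>[of g] by simp
    have "n / ln n \<le> n / (1/2)" using ln2 n by (intro divide_left_mono) auto
    then have le: "N g \<le> 2 * n" using N(2)[of g] by simp
    have "N g powr ((2 * \<beta> + d) / (2 * \<gamma> g * \<beta> + d)) \<le> (2 * n) powr ((2 * \<beta> + d) / (2 * \<gamma> g * \<beta> + d))"
      using le N(1) \<beta> d pos by (intro powr_mono2) auto
    also have "\<dots> \<le> (2 * n) powr e"
      unfolding e_def using n \<beta> d pos by (intro powr_mono divide_left_mono mult_pos_pos add_pos_pos \<gamma>) auto
    finally show "N g powr ((2 * \<beta> + d) / (2 * \<gamma> g * \<beta> + d)) \<le> (2 * n) powr e" .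
  qed
  then have "S \<le> real CARD('g) * (2 * n) powr e" by simp
  then have "S powr r \<le> (real CARD('g) * (2 * n) powr e) powr r"
    using S(2) r by (intro powr_mono2) auto
  also have "\<dots> = real CARD('g) powr r * (2 * n) powr (e * r)"
    by (simp add: powr_mult powr_powr)
  also have "\<dots> \<le> real CARD('g) powr r * (2 * n) powr 2"
  proof (intro mult_left_mono powr_mono)
    have "2 * \<beta> + d \<noteq> 0" using \<beta> d by linarith
    then have "e * r = \<beta> * (1 + \<alpha>) / d" unfolding e_def r_def by simp
    also have "\<dots> = (\<beta> + \<alpha> * \<beta>) / d" by (simp add: algebra_simps)
    also have "\<dots> \<le> (d + d) / d" using \<beta> d \<alpha> by (intro divide_right_mono) auto
    also have "\<dots> = 2" using d by simp
    finally show "e * r \<le> 2" .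
  qed (use n in auto)
  also have "(2 * n) powr 2 = 4 * n\<^sup>2" using n by (simp add: powr_numeral power_mult_distrib)
  finally have "S powr r \<le> 4 * real CARD('g) powr r * n\<^sup>2" by simp
  then have "S powr r * (S powr (- r) / n\<^sup>2) \<le> (4 * real CARD('g) powr r * n\<^sup>2) * (S powr (- r) / n\<^sup>2)"
    by (rule mult_right_mono) auto
  then show ?thesis using S(2) n by (simp add: powr_minus field_simps)
qed

theorem theorem7p3:
  fixes \<alpha> C\<alpha> \<beta> C\<beta> \<mu>lo \<mu>hi c\<mu> r\<mu> :: real
    and \<gamma> Cs :: "'m::finite \<Rightarrow> real"
  assumes "\<alpha> \<ge> 0" and "C\<alpha> > 0" and "0 < \<beta>" and "\<beta> \<le> 1" and "C\<beta> > 0"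
    and "\<And>i. \<gamma> i > 0" and "\<And>i. Cs i > 0"
    and "0 < \<mu>lo" and "\<mu>lo < \<mu>hi" and "c\<mu> > 0" and "r\<mu> > 0"
    and "\<alpha> * \<beta> \<le> real CARD('d::finite)"
  shows "\<exists>C>0. \<forall>(nP :: 'm \<Rightarrow> nat) nQ
            (fa :: ('m option \<times> nat \<Rightarrow> (real^'d) \<times> bool) \<Rightarrow> real^'d \<Rightarrow> bool).
           total_size nP nQ \<ge> 2 \<longrightarrow> data_driven_classifier nP nQ fa \<longrightarrow>
           (SUP (P, \<eta>P, Q, \<eta>Q) \<in> parameter_space \<alpha> C\<alpha> \<beta> C\<beta> \<gamma> Cs \<mu>lo \<mu>hi c\<mu> r\<mu>.
              ereal (expected_excess_risk P Q \<eta>Q nP nQ fa))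
           \<le> ereal (C * (real nQ / ln (real (total_size nP nQ))
                + (\<Sum>i\<in>UNIV. (real (nP i) / ln (real (total_size nP nQ)))
                     powr ((2 * \<beta> + real CARD('d)) / (2 * \<gamma> i * \<beta> + real CARD('d)))))
              powr (- (\<beta> * (1 + \<alpha>) / (2 * \<beta> + real CARD('d)))))"
proof -
  define d where "d = real CARD('d)"
  have d: "d \<ge> 1" unfolding d_def by (simp add: Suc_leI)
  define v where "v = measure lborel (ball (0 :: real^'d) 1)"
  have v: "v > 0" unfolding v_def using content_ball_pos[of 1 "0 :: real^'d"] by simp
  \<comment> \<open>The ball of radius \<open>c \<zeta> powr (1/\<beta>)\<close> stays within the range of the regularity condition and changes \<open>\<eta>\<^sub>Q\<close> by at most \<open>\<zeta>/2\<close>.\<close>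
  define c where "c = min r\<mu> ((1 / (2 * C\<beta>)) powr (1 / \<beta>))"
  have c: "c > 0" "c \<le> r\<mu>" unfolding c_def using assms(5,11) by auto
  have cC: "C\<beta> * c powr \<beta> \<le> 1/2"
  proof -
    have "c powr \<beta> \<le> ((1 / (2 * C\<beta>)) powr (1 / \<beta>)) powr \<beta>"
      using c(1) assms(3) by (intro powr_mono2) (auto simp: c_def)
    also have "\<dots> = 1 / (2 * C\<beta>)" using assms(3,5) by (simp add: powr_powr)
    finally show ?thesis using mult_left_mono[of "c powr \<beta>" "1 / (2 * C\<beta>)" C\<beta>] assms(5) by simp
  qed
  define \<kappa> where "\<kappa> = \<mu>lo * c\<mu> * v * c ^ CARD('d)"
  have \<kappa>: "\<kappa> > 0" unfolding \<kappa>_def using assms(8,10) v c by simp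
  \<comment> \<open>The target is treated as a source with exponent \<open>1\<close> and constant \<open>1\<close>; its term in \<open>S\<close> then has exponent \<open>1\<close>, as in the rate.\<close>
  define \<gamma>' where "\<gamma>' = case_option 1 \<gamma>"
  define Cs' where "Cs' = case_option 1 Cs"
  have \<gamma>': "\<gamma>' g > 0" and Cs': "Cs' g > 0" for g
    unfolding \<gamma>'_def Cs'_def using assms(6,7) by (auto split: option.split)
  \<comment> \<open>The number of observations, in units of \<open>ln n \<zeta> powr (- (2 \<gamma>' g \<beta> + d)/\<beta>)\<close>, with which population \<open>g\<close> alone exceeds the threshold.\<close>
  define A where "A = (\<lambda>g. 8 * (d + 5) / (\<kappa> * (Cs' g * (1/2) powr \<gamma>' g)\<^sup>2))"
  have A: "A g > 0" for g unfolding A_def using d \<kappa> Cs'[of g] by simp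
  define m' where "m' = real CARD('m option)"
  define k where "k = (\<lambda>g. A g powr (\<beta> / (2 * \<gamma>' g * \<beta> + d)) * m' powr (\<beta> / (2 * \<beta> + d)))"
  define K where "K = (\<Sum>g\<in>UNIV. k g)"
  have k0: "k g > 0" for g unfolding k_def m'_def using A[of g] by simp
  have Kk: "K \<ge> k g" for g
    unfolding K_def using k0 by (intro member_le_sum) (auto intro: less_imp_le)
  have K: "K > 0" using k0[of None] Kk[of None] by linarith
  define r where "r = \<beta> * (1 + \<alpha>) / (2 * \<beta> + d)"
  define c2 where "c2 = exp (m' / 2) + 1"
  have c2: "c2 > 0" unfolding c2_def by (intro add_pos_pos) auto
  define C where "C = 2 * C\<alpha> * K powr (1 + \<alpha>) + c2 * (4 * m' powr r)"
  have C: "C > 0" unfolding C_def using assms(2) K c2 by (intro add_pos_nonneg mult_pos_pos) auto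
  show ?thesis
  proof (intro exI[of _ C] conjI C allI impI)
    fix nP :: "'m \<Rightarrow> nat" and nQ and fa :: "('m option \<times> nat \<Rightarrow> (real^'d) \<times> bool) \<Rightarrow> real^'d \<Rightarrow> bool"
    assume n2: "total_size nP nQ \<ge> 2" and clf: "data_driven_classifier nP nQ fa"
    define n where "n = real (total_size nP nQ)"
    have n: "n \<ge> 2" using n2 by (simp add: n_def)
    have lnn: "ln n > 0" using n by simp
    define N where "N = (\<lambda>g. real (case_option nQ nP g) / ln n)"
    define S where "S = (\<Sum>g\<in>UNIV. N g powr ((2 * \<beta> + d) / (2 * \<gamma>' g * \<beta> + d)))"
    have N0: "N g \<ge> 0" for g unfolding N_def using lnn by simp
    have n_sum: "n = (\<Sum>g\<in>UNIV. real (case_option nQ nP g))"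
      unfolding n_def total_size_def sum_UNIV_option by simp
    have N1: "N g \<le> n / ln n" for g
      unfolding N_def n_sum using lnn n_sum by (intro divide_right_mono member_le_sum) auto
    have S0: "S > 0"
    proof -
      have "\<exists>g. real (case_option nQ nP g) > 0"
      proof (rule ccontr)
        assume "\<not> ?thesis"
        then have "n = 0" unfolding n_sum by (intro sum.neutral) (auto simp: not_less)
        then show False using n by simp
      qed
      then obtain g where "real (case_option nQ nP g) > 0" by blast
      then have "N g > 0" unfolding N_def using lnn by (rule divide_pos_pos)
      then have "0 < N g powr ((2 * \<beta> + d) / (2 * \<gamma>' g * \<beta> + d))" by simp
      also have "\<dots> \<le> S" unfolding S_def by (rule member_le_sum) auto
      finally show ?thesis .
    qed
    have S_eq: "real nQ / ln (real (total_size nP nQ)) + (\<Sum>i\<in>UNIV. (real (nP i) / ln (real (total_size nP nQ)))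
                     powr ((2 * \<beta> + real CARD('d)) / (2 * \<gamma> i * \<beta> + real CARD('d)))) = S"
      unfolding S_def sum_UNIV_option N_def \<gamma>'_def n_def[symmetric] d_def[symmetric]
      using assms(3) d lnn by simp
    define t where "t = K * S powr (- (\<beta> / (2 * \<beta> + d)))"
    have t: "t > 0" unfolding t_def using K S0 by simp
    have rate: "2 * t * (C\<alpha> * t powr \<alpha>) + c2 / n\<^sup>2 \<le> C * S powr (- r)"
    proof -
      have "t * t powr \<alpha> = t powr (1 + \<alpha>)" using t by (simp add: powr_add)
      also have "\<dots> = K powr (1 + \<alpha>) * S powr (- (\<beta> / (2 * \<beta> + d)) * (1 + \<alpha>))"
        unfolding t_def by (simp add: powr_mult powr_powr)
      also have "- (\<beta> / (2 * \<beta> + d)) * (1 + \<alpha>) = - r" unfolding r_def by simp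
      finally have 1: "2 * t * (C\<alpha> * t powr \<alpha>) = 2 * C\<alpha> * K powr (1 + \<alpha>) * S powr (- r)" by simp
      have "1 / n\<^sup>2 \<le> 4 * m' powr r * S powr (- r)"
        unfolding m'_def r_def
        by (rule inverse_square_le_rate[OF assms(3,4) d assms(1) _ \<gamma>' n N0 N1 S_def S0]) (use assms(12) in \<open>simp add: d_def\<close>)
      from mult_left_mono[OF this, of c2] c2
      have 2: "c2 / n\<^sup>2 \<le> c2 * (4 * m' powr r) * S powr (- r)" by simp
      show ?thesis unfolding C_def distrib_right 1 using 2 by simp
    qed
    have bound: "expected_excess_risk P Q \<eta>Q nP nQ fa \<le> C * S powr (- r)"
      if ps: "(P, \<eta>P, Q, \<eta>Q) \<in> parameter_space \<alpha> C\<alpha> \<beta> C\<beta> \<gamma> Cs \<mu>lo \<mu>hi c\<mu> r\<mu>" for P \<eta>P and Q :: "((real^'d) \<times> bool) measure" and \<eta>Q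
    proof -
      have popP: "population (P i)" and regP: "regression_function (P i) (\<eta>P i)"
        and popQ: "population Q" and regQ: "regression_function Q \<eta>Q"
        and margin: "u > 0 \<Longrightarrow> measure (covariate_law Q) {x. 0 < \<bar>\<eta>Q x - 1/2\<bar> \<and> \<bar>\<eta>Q x - 1/2\<bar> < u} \<le> C\<alpha> * u powr \<alpha>"
        and suppP: "msupport (covariate_law (P i)) = msupport (covariate_law Q)"
        and densP: "density_between \<mu>lo \<mu>hi (covariate_law (P i))"
        and densQ: "density_between \<mu>lo \<mu>hi (covariate_law Q)"
        for i u using ps unfolding parameter_space_def by auto
      define \<Omega> where "\<Omega> = msupport (covariate_law Q)"
      have transfer: "x \<in> \<Omega> \<Longrightarrow> (\<eta>P i x - 1/2) * (\<eta>Q x - 1/2) \<ge> 0"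
        "x \<in> \<Omega> \<Longrightarrow> \<bar>\<eta>P i x - 1/2\<bar> \<ge> Cs i * \<bar>\<eta>Q x - 1/2\<bar> powr \<gamma> i" for i x
        using ps unfolding parameter_space_def \<Omega>_def by auto
      have holder: "x1 \<in> \<Omega> \<Longrightarrow> x2 \<in> \<Omega> \<Longrightarrow> \<bar>\<eta>Q x1 - \<eta>Q x2\<bar> \<le> C\<beta> * norm (x1 - x2) powr \<beta>" for x1 x2
        using ps unfolding parameter_space_def \<Omega>_def by auto
      have regular: "x \<in> \<Omega> \<Longrightarrow> 0 < r \<Longrightarrow> r \<le> r\<mu> \<Longrightarrow> measure lborel (\<Omega> \<inter> ball x r) \<ge> c\<mu> * measure lborel (ball x r)" for x r
        using ps unfolding parameter_space_def \<Omega>_def by auto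
      define D where "D = case_option Q P"
      define \<eta> where "\<eta> = case_option \<eta>Q \<eta>P"
      have pop: "population (D g)" and reg: "regression_function (D g) (\<eta> g)"
        and supp: "msupport (covariate_law (D g)) = \<Omega>" and dens: "density_between \<mu>lo \<mu>hi (covariate_law (D g))" for g
        unfolding D_def \<eta>_def \<Omega>_def using popP popQ regP regQ suppP densP densQ by (auto split: option.split)
      have sign: "(\<eta> g x - 1/2) * (\<eta>Q x - 1/2) \<ge> 0" and size: "\<bar>\<eta> g x - 1/2\<bar> \<ge> Cs' g * \<bar>\<eta>Q x - 1/2\<bar> powr \<gamma>' g"
        if "x \<in> \<Omega>" for g x
        using transfer[OF that] unfolding \<eta>_def Cs'_def \<gamma>'_def by (auto split: option.split)
      have off: "\<eta> g x = 1/2" if "x \<notin> \<Omega>" for g x using regression_functionD(5)[OF reg, of x g] that supp by simp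
      have data: "data_law P Q nP nQ = PiM (sample_indices nP nQ) (\<lambda>a. D (fst a))"
        unfolding data_law_def D_def by (intro arg_cong2[where f = PiM]) (auto simp: fun_eq_iff)
      have wrong: "emeasure (data_law P Q nP nQ) {\<omega> \<in> space (data_law P Q nP nQ). fa \<omega> x \<noteq> bayes_classifier \<eta>Q x} \<le> ennreal (c2 / n\<^sup>2)"
        if x: "t \<le> \<bar>\<eta>Q x - 1/2\<bar>" "0 < \<bar>\<eta>Q x - 1/2\<bar>" for x
      proof -
        define \<zeta> where "\<zeta> = \<bar>\<eta>Q x - 1/2\<bar>"
        define s where "s = sgn (\<eta>Q x - 1/2)"
        define \<rho> where "\<rho> = c * \<zeta> powr (1 / \<beta>)"
        have s: "\<bar>s\<bar> = 1" "s * (\<eta>Q x - 1/2) = \<zeta>" using x unfolding s_def \<zeta>_def by (auto simp: sgn_if)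
        have \<zeta>: "\<zeta> > 0" "\<zeta> \<le> 1" "t \<le> \<zeta>"
          using x regression_functionD(2,3)[OF regQ, of x] unfolding \<zeta>_def by (auto simp: abs_if)
        have x\<Omega>: "x \<in> \<Omega>" using off[of x None] x by (auto simp: \<eta>_def)
        have \<rho>: "\<rho> > 0" "\<rho> \<le> r\<mu>"
        proof -
          show "\<rho> > 0" unfolding \<rho>_def using c \<zeta> by simp
          have "\<zeta> powr (1 / \<beta>) \<le> 1 powr (1 / \<beta>)" using \<zeta> assms(3) by (intro powr_mono2) auto
          then have "\<rho> \<le> c * 1" unfolding \<rho>_def using c by (intro mult_left_mono) auto
          then show "\<rho> \<le> r\<mu>" using c by simp
        qed
        have near: "s * (\<eta>Q z - 1/2) \<ge> \<zeta> / 2" if "dist x z < \<rho>" "z \<in> \<Omega>" for z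
        proof -
          have "\<bar>\<eta>Q x - \<eta>Q z\<bar> \<le> C\<beta> * norm (x - z) powr \<beta>" by (rule holder[OF x\<Omega> that(2)])
          also have "\<dots> \<le> C\<beta> * \<rho> powr \<beta>"
            using that(1) assms(3,5) by (intro mult_left_mono powr_mono2) (auto simp: dist_norm)
          also have "\<dots> = (C\<beta> * c powr \<beta>) * \<zeta>"
            unfolding \<rho>_def using assms(3) c \<zeta> by (simp add: powr_mult powr_powr)
          also have "\<dots> \<le> 1/2 * \<zeta>" using cC \<zeta> by (intro mult_right_mono) auto
          finally have close: "\<bar>\<eta>Q x - \<eta>Q z\<bar> \<le> \<zeta> / 2" by simp
          have "s = 1 \<or> s = - 1" using s(1) by auto
          then show ?thesis
          proof
            assume s1: "s = 1"
            show ?thesis using s(2) abs_le_D1[OF close] unfolding s1 by (simp add: field_simps)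
          next
            assume s1: "s = - 1"
            show ?thesis using s(2) abs_le_D2[OF close] unfolding s1 by (simp add: field_simps)
          qed
        qed
        have same: "s * (\<eta> g z - 1/2) \<ge> 0" if "dist x z < \<rho>" for g z
        proof (cases "z \<in> \<Omega>")
          case True
          have "s = 1 \<or> s = - 1" using s(1) by auto
          then show ?thesis using near[OF that True] \<zeta>(1) sign[OF True, of g]
            by (auto simp: zero_le_mult_iff)
        qed (simp add: off)
        have "\<exists>g. A g \<le> N g * \<zeta> powr ((2 * \<gamma>' g * \<beta> + d) / \<beta>)"
          by (rule exists_informative_sample[where K = K, OF assms(3) _ \<gamma>' N0 A S_def S0])
             (use d Kk \<zeta>(3) in \<open>simp_all add: k_def m'_def t_def\<close>)
        then obtain g where g: "A g \<le> N g * \<zeta> powr ((2 * \<gamma>' g * \<beta> + d) / \<beta>)" by blast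
        define \<tau> where "\<tau> = Cs' g * (\<zeta> / 2) powr \<gamma>' g"
        define p where "p = \<kappa> * \<zeta> powr (d / \<beta>)"
        have gain: "s * (\<eta> g z - 1/2) \<ge> \<tau>" if "dist x z < \<rho>" "z \<in> \<Omega>" for z
        proof -
          have "(\<zeta> / 2) powr \<gamma>' g \<le> \<bar>\<eta>Q z - 1/2\<bar> powr \<gamma>' g"
          proof (rule powr_mono2)
            have "\<bar>s * (\<eta>Q z - 1/2)\<bar> = \<bar>\<eta>Q z - 1/2\<bar>" using s(1) by (simp add: abs_mult)
            then show "\<zeta> / 2 \<le> \<bar>\<eta>Q z - 1/2\<bar>" using near[OF that] by linarith
          qed (use \<gamma>'[of g] \<zeta> in auto)
          then have "\<tau> \<le> Cs' g * \<bar>\<eta>Q z - 1/2\<bar> powr \<gamma>' g"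
            unfolding \<tau>_def using Cs'[of g] by (intro mult_left_mono) auto
          also have "\<dots> \<le> \<bar>\<eta> g z - 1/2\<bar>" by (rule size[OF that(2)])
          also have "\<dots> = \<bar>s * (\<eta> g z - 1/2)\<bar>" using s(1) by (simp add: abs_mult)
          also have "\<dots> = s * (\<eta> g z - 1/2)" using same[OF that(1)] by simp
          finally show ?thesis .
        qed
        have \<tau>: "0 \<le> \<tau>" "\<tau> \<le> 1/2"
        proof -
          show "0 \<le> \<tau>" unfolding \<tau>_def using Cs'[of g] by simp
          have "\<tau> \<le> s * (\<eta> g x - 1/2)" using \<rho> x\<Omega> by (intro gain) auto
          also have "\<dots> \<le> \<bar>s\<bar> * \<bar>\<eta> g x - 1/2\<bar>" by (metis abs_ge_self abs_mult)
          also have "\<dots> \<le> 1/2" using s(1) regression_functionD(2,3)[OF reg, of g x] by (simp add: abs_if field_simps)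
          finally show "\<tau> \<le> 1/2" .
        qed
        have ball: "measure lborel (ball x \<rho>) = \<rho> ^ CARD('d) * v"
          unfolding v_def using content_ball_conv_unit_ball[of \<rho> x] \<rho> by simp
        have p: "0 \<le> p" "p \<le> measure (covariate_law (D g)) (ball x \<rho>)"
        proof -
          show "0 \<le> p" unfolding p_def using \<kappa> by simp
          have "\<rho> ^ CARD('d) = c ^ CARD('d) * \<zeta> powr (d / \<beta>)"
            unfolding \<rho>_def power_mult_distrib using \<zeta> by (simp add: powr_realpow[symmetric] powr_powr d_def)
          then have "p = \<mu>lo * c\<mu> * measure lborel (ball x \<rho>)" unfolding p_def \<kappa>_def ball by simp
          also have "\<dots> \<le> measure (covariate_law (D g)) (ball x \<rho>)"
            using regular[OF x\<Omega> \<rho>] supp[of g]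
            by (intro density_between_ball[OF dens population_D(4)[OF pop] assms(8)]) simp
          finally show "p \<le> measure (covariate_law (D g)) (ball x \<rho>)" .
        qed
        have gainAE: "AE z in covariate_law (D g). dist x z < \<rho> \<longrightarrow> s * (\<eta> g z - 1/2) \<ge> \<tau>"
          using AE_in_msupport[OF population_D(5)[OF pop[of g]]] gain unfolding supp by auto
        have budget: "8 * (real CARD('d) + 5) * ln (real (total_size nP nQ)) \<le> real (case_option nQ nP g) * p * \<tau>\<^sup>2"
        proof -
          have "\<tau> = Cs' g * (1/2) powr \<gamma>' g * \<zeta> powr \<gamma>' g"
            unfolding \<tau>_def by (simp add: powr_divide)
          then have "p * \<tau>\<^sup>2 = \<kappa> * (Cs' g * (1/2) powr \<gamma>' g)\<^sup>2 * (\<zeta> powr (d / \<beta>) * (\<zeta> powr \<gamma>' g)\<^sup>2)"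
            unfolding p_def by (simp add: power_mult_distrib)
          also have "(\<zeta> powr \<gamma>' g)\<^sup>2 = \<zeta> powr (2 * \<gamma>' g)" by (simp add: power2_eq_square flip: powr_add)
          also have "\<zeta> powr (d / \<beta>) * \<zeta> powr (2 * \<gamma>' g) = \<zeta> powr ((2 * \<gamma>' g * \<beta> + d) / \<beta>)"
            using assms(3) by (simp add: add_divide_distrib add.commute flip: powr_add)
          finally have p\<tau>: "p * \<tau>\<^sup>2 = \<kappa> * (Cs' g * (1/2) powr \<gamma>' g)\<^sup>2 * \<zeta> powr ((2 * \<gamma>' g * \<beta> + d) / \<beta>)" .
          define b where "b = \<kappa> * (Cs' g * (1/2) powr \<gamma>' g)\<^sup>2"
          have b: "b > 0" unfolding b_def using \<kappa> Cs'[of g] by simp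
          have "8 * (d + 5) * ln n = A g * b * ln n" unfolding A_def b_def[symmetric] using b by simp
          also have "\<dots> \<le> (N g * \<zeta> powr ((2 * \<gamma>' g * \<beta> + d) / \<beta>)) * b * ln n"
            using g b lnn by (intro mult_right_mono) auto
          also have "\<dots> = real (case_option nQ nP g) * (p * \<tau>\<^sup>2)"
            unfolding p\<tau> b_def[symmetric] N_def using lnn by simp
          finally show ?thesis unfolding d_def n_def by (simp add: mult.assoc)
        qed
        have bayes: "bayes_classifier \<eta>Q x \<longleftrightarrow> s = 1"
          using x unfolding bayes_classifier_def s_def by (auto simp: sgn_if)
        show ?thesis
          using prob_misclassified[where D = D and \<eta> = \<eta> and g = g, OF n2 clf pop reg density_between_sphere[OF dens] s(1) same \<tau> p gainAE budget]
          unfolding data bayes c2_def m'_def n_def .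
      qed
      have fam: "(\<lambda>(\<omega>, x). fa \<omega> x) \<in> measurable (data_space nP nQ \<Otimes>\<^sub>M borel) (count_space UNIV)"
        using clf unfolding data_driven_classifier_def by blast
      have "expected_excess_risk P Q \<eta>Q nP nQ fa
        \<le> 2 * t * measure (covariate_law Q) {x. 0 < \<bar>\<eta>Q x - 1/2\<bar> \<and> \<bar>\<eta>Q x - 1/2\<bar> < t} + c2 / n\<^sup>2"
        using t c2 by (intro expected_excess_risk_le[OF popP popQ regQ fam] wrong) auto
      also have "\<dots> \<le> 2 * t * (C\<alpha> * t powr \<alpha>) + c2 / n\<^sup>2"
        using t margin[OF t] by (intro add_right_mono mult_left_mono) auto
      also have "\<dots> \<le> C * S powr (- r)" by (rule rate)
      finally show ?thesis .
    qed
    show "(SUP (P, \<eta>P, Q, \<eta>Q) \<in> parameter_space \<alpha> C\<alpha> \<beta> C\<beta> \<gamma> Cs \<mu>lo \<mu>hi c\<mu> r\<mu>.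
              ereal (expected_excess_risk P Q \<eta>Q nP nQ fa))
           \<le> ereal (C * (real nQ / ln (real (total_size nP nQ))
                + (\<Sum>i\<in>UNIV. (real (nP i) / ln (real (total_size nP nQ)))
                     powr ((2 * \<beta> + real CARD('d)) / (2 * \<gamma> i * \<beta> + real CARD('d)))))
              powr (- (\<beta> * (1 + \<alpha>) / (2 * \<beta> + real CARD('d)))))"
      unfolding S_eq unfolding d_def[symmetric] r_def[symmetric]
      by (rule SUP_least) (use bound in auto)
  qed
qed

end
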